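(* Let $\pi^c=(T-1,f,\dots,f)\in\Pi^c$ be a constant shipment policy and $\pi^{cc}=(\bar\tau,f',\dots,f')\in\Pi^{cc}\setminus\Pi^c$ a constant cutoff point shipment policy (so $\bar\tau<T-1$). Suppose that $C^{\pi^c}_{T-1}=C^{\pi^{cc}}_{T-1}$. Then: (1) $\pi^{cc}$ charges a smaller express shipment fee than $\pi^c$, i.e. $f'<f$. (2) $\pi^{cc}$ generates fewer expected backorders than $\pi^c$, i.e. $\mathbb{E}[B^{\pi^{cc}}]\le\mathbb{E}[B^{\pi^c}]$. (3) $\pi^{cc}$ yields a higher expected profit than $\pi^c$, i.e. $\mathbb{E}[G^{\pi^{cc}}]\ge\mathbb{E}[G^{\pi^c}]$, if and only if $$\beta\ \ge\ (f-f')\cdot\frac{C^{\pi^{cc}}_{T-1}}{\mathbb{E}[B^{\pi^c}]-\mathbb{E}[B^{\pi^{cc}}]}.$$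
   Context: Model. Fix $T\in\mathbb{N}$, $T\ge 1$, $\lambda>0$, $\beta>0$, reals $0\le U_{\min}<U_{\max}<\infty$, and a discrete random variable $K$ with support $\mathbb{N}_0$ such that $\rho=\lambda/\mathbb{E}[K]<1$. Put $w(f)=\frac{U_{\max}-f}{U_{\max}-U_{\min}}$ for $f\in[U_{\min},U_{\max}]$. Policies. A shipment policy is $\pi=(\bar\tau,f_0,\dots,f_{\bar\tau})$ with cutoff point $\bar\tau\in\{0,\dots,T-1\}$ and fees $f_\tau\in[U_{\min},U_{\max}]$ for $\tau=0,\dots,\bar\tau$; $\Pi$ is the set of all of them. $\Pi^{cc}$ is the set of constant cutoff point policies $(\bar\tau,f,\dots,f)$ with $\bar\tau\in\{0,\dots,T-1\}$, $f\in[U_{\min},U_{\max}]$; $\Pi^c\subset\Pi^{cc}$ is the set of constant policies, those with $\bar\tau=T-1$. Dynamics under $\pi$. Time is $t\in\mathbb{N}_0$; the age is $\tau=t \bmod T$; cycle $l$ is $\{lT,\dots,lT+T-1\}$. For each $t$ with age $\tau$: if $\tau\le\bar\tau$, $E_t\sim\mathrm{Poi}(w(f_\tau)\lambda)$ (express orders) and $N_t\sim\mathrm{Poi}((1-w(f_\tau))\lambda)$ (regular orders); if $\tau>\bar\tau$, $E_t=0$ and $N_t\sim\mathrm{Poi}(\lambda)$. Let $D_t=E_t+N_t$, and $K_t\sim K$ (processing capacity). All $E_t,N_t,K_t$, $t\in\mathbb{N}_0$, are independent. The total backlog $X^\Sigma$ and the high-urgency backlog $X^h$ evolve by $X^\Sigma_{t+1}=(X^\Sigma_t+D_t-K_t)^+$,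 and $X^h_{t+1}=(X^h_t+E_t-K_t)^+$ if $t\bmod T\ne T-1$, $X^h_{t+1}=(X^\Sigma_t+D_t-K_t)^+$ if $t\bmod T=T-1$, where $x^+=\max(x,0)$, from a fixed deterministic initial state with $X^h_0\le X^\Sigma_0$. Performance. The backorders of cycle $l$ are $B_l=(X^h_{lT+T-1}+E_{lT+T-1}-K_{lT+T-1})^+$, and $\mathbb{E}[B^\pi]=\lim_{L\to\infty}\frac1L\sum_{l=0}^{L-1}\mathbb{E}[B_l]$ is their long-run average under $\pi$. The expected revenue is $\mathbb{E}[R^\pi]=\lambda\sum_{\tau=0}^{\bar\tau}f_\tau w(f_\tau)$ and the expected profit is $\mathbb{E}[G^\pi]=\mathbb{E}[R^\pi]-\beta\,\mathbb{E}[B^\pi]$; $\beta$ is the penalty cost rate per backorder. Demand profile. $C^\pi_\tau=\lambda\sum_{j=0}^{\min(\tau,\bar\tau)}w(f_j)$ for $\tau\in\{0,\dots,T-1\}$ is the expected cumulative number of express orders up to age $\tau$; $C^\pi_{T-1}$ is the expected number of express orders per cycle.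
   Formalization: Part (1) is stated only for f < U_max, since for f = U_max equal demand forces f' = f = U_max and f' < f fails; in that case the quotient in (3) is 0/0 and is read as 0, and both sides of the equivalence hold. *)

theory Defs
  imports "HOL-Probability.Probability"
begin

text \<open>A policy is its cutoff point together with the list of the fees for the ages up to and
  including the cutoff point.\<close>

type_synonym policy = "nat \<times> real list"

abbreviation cutoff :: "policy \<Rightarrow> nat" where
  "cutoff \<pi> \<equiv> fst \<pi>"

abbreviation fee :: "policy \<Rightarrow> nat \<Rightarrow> real" where
  "fee \<pi> \<tau> \<equiv> snd \<pi> ! \<tau>"

definition policies :: "nat \<Rightarrow> real \<Rightarrow> real \<Rightarrow> policy set" where
  "policies T Umin Umax =
     {\<pi>. cutoff \<pi> < T \<and> length (snd \<pi>) = Suc (cutoff \<pi>) \<and> set (snd \<pi>) \<subseteq> {Umin..Umax}}"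

definition const_policy :: "nat \<Rightarrow> real \<Rightarrow> policy" where
  "const_policy \<tau> f = (\<tau>, replicate (Suc \<tau>) f)"

definition const_cutoff_policies :: "nat \<Rightarrow> real \<Rightarrow> real \<Rightarrow> policy set" where
  "const_cutoff_policies T Umin Umax =
     {\<pi> \<in> policies T Umin Umax. \<exists>\<tau> f. \<pi> = const_policy \<tau> f}"

definition const_policies :: "nat \<Rightarrow> real \<Rightarrow> real \<Rightarrow> policy set" where
  "const_policies T Umin Umax = {\<pi> \<in> const_cutoff_policies T Umin Umax. cutoff \<pi> = T - 1}"

definition express_share :: "real \<Rightarrow> real \<Rightarrow> real \<Rightarrow> real" where
  "express_share Umin Umax f = (Umax - f) / (Umax - Umin)"

text \<open>The constant \<^const>\<open>poisson_pmf\<close> is specified for positive rates only, but rate 0 occurs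
  here: for regular orders at the fee \<open>Umin\<close>, for express orders at the fee \<open>Umax\<close>.\<close>

definition poisson0_pmf :: "real \<Rightarrow> nat pmf" where
  "poisson0_pmf r = (if r = 0 then return_pmf 0 else poisson_pmf r)"

definition express_law :: "real \<Rightarrow> real \<Rightarrow> real \<Rightarrow> policy \<Rightarrow> nat \<Rightarrow> nat pmf" where
  "express_law lam Umin Umax \<pi> \<tau> =
     (if \<tau> \<le> cutoff \<pi> then poisson0_pmf (express_share Umin Umax (fee \<pi> \<tau>) * lam)
      else return_pmf 0)"

definition regular_law :: "real \<Rightarrow> real \<Rightarrow> real \<Rightarrow> policy \<Rightarrow> nat \<Rightarrow> nat pmf" where
  "regular_law lam Umin Umax \<pi> \<tau> =
     (if \<tau> \<le> cutoff \<pi> then poisson0_pmf ((1 - express_share Umin Umax (fee \<pi> \<tau>)) * lam)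
      else poisson0_pmf lam)"

datatype source = Express | Regular | Capacity

text \<open>A realisation, on some probability space, of the orders and capacities under the policy
  \<open>\<pi>\<close>; \<open>cap\<close> is the distribution of the capacity.\<close>

locale shipment_process = prob_space M for M :: "'a measure" +
  fixes T :: nat and lam Umin Umax :: real and cap :: "nat pmf" and \<pi> :: policy
    and E N K :: "nat \<Rightarrow> 'a \<Rightarrow> nat"
  assumes indep: "indep_vars (\<lambda>_. count_space UNIV)
      (\<lambda>(s, t). case s of Express \<Rightarrow> E t | Regular \<Rightarrow> N t | Capacity \<Rightarrow> K t)
      (UNIV :: (source \<times> nat) set)"
    and distr_E: "\<And>t. distr M (count_space UNIV) (E t) =
      measure_pmf (express_law lam Umin Umax \<pi> (t mod T))"
    and distr_N: "\<And>t. distr M (count_space UNIV) (N t) =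
      measure_pmf (regular_law lam Umin Umax \<pi> (t mod T))"
    and distr_K: "\<And>t. distr M (count_space UNIV) (K t) = measure_pmf cap"

text \<open>Sample paths of the backlogs, for sequences \<open>e\<close>, \<open>n\<close> and \<open>k\<close> of express orders, regular
  orders and capacities. Subtraction on \<^typ>\<open>nat\<close> is truncated at 0, so it is the positive part.\<close>

primrec total_backlog :: "nat \<Rightarrow> (nat \<Rightarrow> nat) \<Rightarrow> (nat \<Rightarrow> nat) \<Rightarrow> (nat \<Rightarrow> nat) \<Rightarrow> nat \<Rightarrow> nat" where
  "total_backlog xS e n k 0 = xS"
| "total_backlog xS e n k (Suc t) = total_backlog xS e n k t + (e t + n t) - k t"

primrec high_backlog ::
  "nat \<Rightarrow> nat \<Rightarrow> nat \<Rightarrow> (nat \<Rightarrow> nat) \<Rightarrow> (nat \<Rightarrow> nat) \<Rightarrow> (nat \<Rightarrow> nat) \<Rightarrow> nat \<Rightarrow> nat" where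
  "high_backlog T xS xh e n k 0 = xh"
| "high_backlog T xS xh e n k (Suc t) =
     (if t mod T \<noteq> T - 1 then high_backlog T xS xh e n k t + e t - k t
      else total_backlog xS e n k t + (e t + n t) - k t)"

definition backorders ::
  "nat \<Rightarrow> nat \<Rightarrow> nat \<Rightarrow> (nat \<Rightarrow> nat) \<Rightarrow> (nat \<Rightarrow> nat) \<Rightarrow> (nat \<Rightarrow> nat) \<Rightarrow> nat \<Rightarrow> nat" where
  "backorders T xS xh e n k l =
     (let t = l * T + T - 1 in high_backlog T xS xh e n k t + e t - k t)"

definition expected_backorders ::
  "'a measure \<Rightarrow> nat \<Rightarrow> nat \<Rightarrow> nat \<Rightarrow> (nat \<Rightarrow> 'a \<Rightarrow> nat) \<Rightarrow> (nat \<Rightarrow> 'a \<Rightarrow> nat) \<Rightarrow> (nat \<Rightarrow> 'a \<Rightarrow> nat)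
     \<Rightarrow> real" where
  "expected_backorders M T xS xh E N K =
     lim (\<lambda>L. (1 / real L) * (\<Sum>l<L. \<integral>\<omega>.
       real (backorders T xS xh (\<lambda>t. E t \<omega>) (\<lambda>t. N t \<omega>) (\<lambda>t. K t \<omega>) l) \<partial>M))"

definition expected_revenue :: "real \<Rightarrow> real \<Rightarrow> real \<Rightarrow> policy \<Rightarrow> real" where
  "expected_revenue lam Umin Umax \<pi> =
     lam * (\<Sum>\<tau>\<le>cutoff \<pi>. fee \<pi> \<tau> * express_share Umin Umax (fee \<pi> \<tau>))"

definition demand_profile :: "real \<Rightarrow> real \<Rightarrow> real \<Rightarrow> policy \<Rightarrow> nat \<Rightarrow> real" where
  "demand_profile lam Umin Umax \<pi> \<tau> =
     lam * (\<Sum>j\<le>min \<tau> (cutoff \<pi>). express_share Umin Umax (fee \<pi> j))"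

definition expected_profit ::
  "real \<Rightarrow> real \<Rightarrow> real \<Rightarrow> real \<Rightarrow> policy \<Rightarrow> 'a measure \<Rightarrow> nat \<Rightarrow> nat \<Rightarrow> nat
     \<Rightarrow> (nat \<Rightarrow> 'a \<Rightarrow> nat) \<Rightarrow> (nat \<Rightarrow> 'a \<Rightarrow> nat) \<Rightarrow> (nat \<Rightarrow> 'a \<Rightarrow> nat) \<Rightarrow> real" where
  "expected_profit \<beta> lam Umin Umax \<pi> M T xS xh E N K =
     expected_revenue lam Umin Umax \<pi> - \<beta> * expected_backorders M T xS xh E N K"

end

theory Submission
  imports Defs
begin

text \<open>
  The total backlog moves in the same way under both policies: express and regular orders of a
  period add up to a Poisson number of rate \<open>lam\<close>, however the fees split them. Only the
  high-urgency backlog within a cycle depends on the policy, and it is reset to the total backlog at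
  every cycle boundary. So in every cycle after the first the expected backorders are
  \<open>h x\<close>, where \<open>x\<close> is the total backlog at the start of the cycle and the function \<open>h\<close> records
  what one cycle of express orders and service does; comparing the policies means comparing their two
  functions \<open>h\<close> and averaging both against the same law of \<open>x\<close>.

  \<^emph>\<open>Comparison within a cycle.\<close> Both policies have the same expected number of express orders per
  cycle, but the cutoff policy concentrates them on the early ages. Poisson orders of a rate \<open>s\<close> that
  come before a service step can use capacity that would be wasted if they came after it, so
  moving them forward can only lower the backlog, and lowers it strictly with positive
  probability (\<open>arrive_serve_less_serve_arrive\<close>). Shifting the surplus rate through the cycle age
  by age gives \<open>h' x < h x\<close> for every \<open>x\<close>, where \<open>h'\<close> belongs to the cutoff policy
  (\<open>stages_earlier_less\<close>).

  \<^emph>\<open>Long run.\<close> The expected capacity exceeds \<open>lam\<close>, so some \<open>q > 1\<close> has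
  \<open>phi = E (q ^ (D - K)) < 1\<close> for the demand \<open>D\<close> and the capacity \<open>K\<close> of one period
  (\<open>exists_geometric_drift\<close>). One period shrinks the Lipschitz constant of a function with respect to
  \<open>q ^ x\<close> by the factor \<open>phi\<close>; hence the expectations of \<open>h\<close> along the total backlog form a Cauchy sequence
  and the long-run average of the backorders is their limit (\<open>periods_convergent\<close>,
  \<open>expected_backorders_limit\<close>). The same \<open>q ^ x\<close> is a Lyapunov function that keeps the total backlog
  tight, and so the strict inequality between \<open>h'\<close> and \<open>h\<close> survives in the limit
  (\<open>periods_gap\<close>).

  Strictness is what the profit criterion rests on: the revenues are the fees times the common
  expected number of express orders, so the criterion is the inequality between profits divided by
  the difference of the backorders, which must be positive. The exception is a fee
  \<open>f = Umax\<close>: then nobody orders express under either policy, the two processes have the same law and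
  both sides of the criterion hold.
\<close>

section \<open>Averaging operators on functions of the backlog\<close>

text \<open>This class of functions is integrable against Poisson arrivals, is closed under all operators
  below, and contains both the backlog itself and the Lyapunov functions \<open>q ^ x\<close>.\<close>

definition exp_bounded :: "(nat \<Rightarrow> real) \<Rightarrow> bool" where
  "exp_bounded g \<longleftrightarrow> (\<exists>C q. 1 \<le> q \<and> (\<forall>n. \<bar>g n\<bar> \<le> C * q ^ n))"

lemma exp_boundedI: "1 \<le> q \<Longrightarrow> (\<And>n. \<bar>g n\<bar> \<le> C * q ^ n) \<Longrightarrow> exp_bounded g"
  unfolding exp_bounded_def by blast

lemma exp_boundedE:
  assumes "exp_bounded g"
  obtains C q where "1 \<le> q" "0 \<le> C" "\<And>n. \<bar>g n\<bar> \<le> C * q ^ n"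
proof -
  obtain C q where q: "1 \<le> q" "\<And>n. \<bar>g n\<bar> \<le> C * q ^ n"
    using assms unfolding exp_bounded_def by blast
  moreover have "0 \<le> C" using q(2)[of 0] by (smt (verit) mult_cancel_left1 power_0)
  ultimately show thesis using that by blast
qed

lemma exp_bounded_linear:
  assumes "exp_bounded g" "exp_bounded h"
  shows "exp_bounded (\<lambda>x. a * g x + b * h x)"
proof -
  obtain C q where g: "1 \<le> q" "0 \<le> C" "\<And>n. \<bar>g n\<bar> \<le> C * q ^ n"
    by (rule exp_boundedE[OF assms(1)]) blast
  obtain D r where h: "1 \<le> r" "0 \<le> D" "\<And>n. \<bar>h n\<bar> \<le> D * r ^ n"
    by (rule exp_boundedE[OF assms(2)]) blast
  show ?thesis
  proof (rule exp_boundedI)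
    show "1 \<le> max q r" using g by simp
    fix n
    have "\<bar>a * g n + b * h n\<bar> \<le> \<bar>a\<bar> * \<bar>g n\<bar> + \<bar>b\<bar> * \<bar>h n\<bar>"
      by (metis abs_mult abs_triangle_ineq)
    also have "\<dots> \<le> \<bar>a\<bar> * (C * max q r ^ n) + \<bar>b\<bar> * (D * max q r ^ n)"
    proof (intro add_mono mult_left_mono)
      show "\<bar>g n\<bar> \<le> C * max q r ^ n"
        by (rule order_trans[OF g(3)]) (use g in \<open>auto intro!: mult_left_mono power_mono\<close>)
      show "\<bar>h n\<bar> \<le> D * max q r ^ n"
        by (rule order_trans[OF h(3)]) (use h in \<open>auto intro!: mult_left_mono power_mono\<close>)
    qed auto
    finally show "\<bar>a * g n + b * h n\<bar> \<le> (\<bar>a\<bar> * C + \<bar>b\<bar> * D) * max q r ^ n"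
      by (simp add: algebra_simps)
  qed
qed

lemma exp_bounded_const: "exp_bounded (\<lambda>_. c)"
  by (rule exp_boundedI[of 1 _ "\<bar>c\<bar>"]) auto

lemma exp_bounded_power: "1 \<le> q \<Longrightarrow> exp_bounded (\<lambda>n. q ^ n)"
  by (rule exp_boundedI[of q _ 1]) auto

lemma exp_bounded_real: "exp_bounded real"
  by (rule exp_boundedI[of 2 _ 1]) (simp_all add: less_imp_le of_nat_less_two_power)

text \<open>The properties of a Markov operator on exponentially bounded functions that the proof uses. They
  pass to compositions and iterates, so that single arrivals, service steps, whole cycles and long
  runs can be treated alike.\<close>

definition averaging :: "((nat \<Rightarrow> real) \<Rightarrow> nat \<Rightarrow> real) \<Rightarrow> bool" where
  "averaging F \<longleftrightarrow>
     (\<forall>g. exp_bounded g \<longrightarrow> exp_bounded (F g)) \<and>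
     (\<forall>g h a b. exp_bounded g \<longrightarrow> exp_bounded h \<longrightarrow>
        F (\<lambda>x. a * g x + b * h x) = (\<lambda>x. a * F g x + b * F h x)) \<and>
     (\<forall>c. F (\<lambda>_. c) = (\<lambda>_. c)) \<and>
     (\<forall>g h. exp_bounded g \<longrightarrow> exp_bounded h \<longrightarrow> (\<forall>x. g x \<le> h x) \<longrightarrow> (\<forall>x. F g x \<le> F h x)) \<and>
     (\<forall>g h. exp_bounded g \<longrightarrow> exp_bounded h \<longrightarrow> (\<forall>x. g x < h x) \<longrightarrow> (\<forall>x. F g x < F h x))"

lemma averagingD:
  assumes "averaging F"
  shows averaging_exp_bounded: "exp_bounded g \<Longrightarrow> exp_bounded (F g)"
    and averaging_linear: "exp_bounded g \<Longrightarrow> exp_bounded h \<Longrightarrow>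
      F (\<lambda>x. a * g x + b * h x) = (\<lambda>x. a * F g x + b * F h x)"
    and averaging_const: "F (\<lambda>_. c) = (\<lambda>_. c)"
    and averaging_mono: "exp_bounded g \<Longrightarrow> exp_bounded h \<Longrightarrow> (\<And>x. g x \<le> h x) \<Longrightarrow> F g x \<le> F h x"
    and averaging_strict: "exp_bounded g \<Longrightarrow> exp_bounded h \<Longrightarrow> (\<And>x. g x < h x) \<Longrightarrow> F g x < F h x"
  using assms unfolding averaging_def by blast+

lemma averaging_affine:
  assumes "averaging F" "exp_bounded g" "exp_bounded h"
  shows "F (\<lambda>x. g x + (b * h x + c)) = (\<lambda>x. F g x + (b * F h x + c))"
proof -
  have "F (\<lambda>x. 1 * g x + 1 * (b * h x + 1 * c)) = (\<lambda>x. 1 * F g x + 1 * F (\<lambda>x. b * h x + 1 * c) x)"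
    by (rule averaging_linear[OF assms(1,2)])
      (intro exp_bounded_linear assms exp_bounded_const)
  moreover have "F (\<lambda>x. b * h x + 1 * c) = (\<lambda>x. b * F h x + 1 * F (\<lambda>_. c) x)"
    by (rule averaging_linear[OF assms(1,3) exp_bounded_const])
  ultimately show ?thesis by (simp add: averaging_const[OF assms(1)])
qed

lemma averaging_affine':
  assumes "averaging F" "exp_bounded h"
  shows "F (\<lambda>x. b * h x + c) = (\<lambda>x. b * F h x + c)"
  using averaging_affine[OF assms(1) exp_bounded_const[of 0] assms(2), of b c]
  by (simp add: averaging_const[OF assms(1)])

lemma averaging_nonneg:
  assumes "averaging F" "exp_bounded g" "\<And>x. 0 \<le> g x"
  shows "0 \<le> F g x"
  using averaging_mono[OF assms(1) exp_bounded_const[of 0] assms(2), of x] assms(3)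
  by (simp add: averaging_const[OF assms(1)])

lemma averaging_comp: "averaging F \<Longrightarrow> averaging G \<Longrightarrow> averaging (\<lambda>g. F (G g))"
  unfolding averaging_def by auto

lemma averaging_funpow: "averaging F \<Longrightarrow> averaging (F ^^ n)"
proof (induction n)
  case 0
  show ?case by (simp add: averaging_def)
next
  case (Suc n)
  then show ?case using averaging_comp[of F "F ^^ n"] by (simp add: o_def)
qed

lemma expectation_less:
  fixes u v :: "'i \<Rightarrow> real"
  assumes "integrable (measure_pmf p) u" "integrable (measure_pmf p) v"
    and "\<And>i. u i \<le> v i" and "i \<in> set_pmf p" "u i < v i"
  shows "measure_pmf.expectation p u < measure_pmf.expectation p v"
proof (rule measure_pmf.integral_less_AE[OF assms(1,2)])
  show "emeasure (measure_pmf p) {i} \<noteq> 0"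
    using assms(4) by (simp add: emeasure_pmf_single pmf_eq_0_set_pmf)
qed (use assms in auto)

lemma averaging_expectation:
  assumes int: "\<And>g x. exp_bounded g \<Longrightarrow> integrable (measure_pmf p) (\<lambda>i. g (a x i))"
    and "\<And>g. exp_bounded g \<Longrightarrow> exp_bounded (\<lambda>x. measure_pmf.expectation p (\<lambda>i. g (a x i)))"
  shows "averaging (\<lambda>g x. measure_pmf.expectation p (\<lambda>i. g (a x i)))"
  unfolding averaging_def
proof (intro conjI allI impI)
  fix g h :: "nat \<Rightarrow> real" and x
  assume *: "exp_bounded g" "exp_bounded h" "\<forall>x. g x < h x"
  obtain i where "i \<in> set_pmf p" using set_pmf_not_empty[of p] by blast
  then show "measure_pmf.expectation p (\<lambda>i. g (a x i)) < measure_pmf.expectation p (\<lambda>i. h (a x i))"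
    using * by (intro expectation_less int) (auto intro: less_imp_le)
qed (use assms in \<open>auto intro!: integral_mono\<close>)

lemma pmf_poisson0: "0 \<le> r \<Longrightarrow> pmf (poisson0_pmf r) n = r ^ n / fact n * exp (- r)"
  by (cases "n = 0") (auto simp: poisson0_pmf_def)

text \<open>The probability generating function of the Poisson distribution.\<close>

lemma nn_integral_poisson0_power:
  assumes "0 \<le> r" "0 \<le> q"
  shows "(\<integral>\<^sup>+n. ennreal (q ^ n) \<partial>measure_pmf (poisson0_pmf r)) = ennreal (exp (r * (q - 1)))"
proof -
  have s: "(\<lambda>n. exp (- r) * ((r * q) ^ n /\<^sub>R fact n)) sums (exp (- r) * exp (r * q))"
    by (intro sums_mult exp_converges)
  have "(\<integral>\<^sup>+n. ennreal (q ^ n) \<partial>measure_pmf (poisson0_pmf r)) =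
      (\<Sum>n. ennreal (exp (- r) * ((r * q) ^ n /\<^sub>R fact n)))"
    using assms
    by (auto simp: nn_integral_measure_pmf nn_integral_count_space_nat pmf_poisson0
        ennreal_mult'[symmetric] power_mult_distrib field_simps intro!: suminf_cong)
  also have "\<dots> = ennreal (exp (- r) * exp (r * q))"
    using s assms by (subst suminf_ennreal2) (auto simp: sums_iff)
  also have "exp (- r) * exp (r * q) = exp (r * (q - 1))"
    by (simp add: mult_exp_exp algebra_simps)
  finally show ?thesis .
qed

lemma poisson0_power:
  assumes "0 \<le> r" "0 \<le> q"
  shows integrable_poisson0_power: "integrable (measure_pmf (poisson0_pmf r)) (\<lambda>n. q ^ n)"
    and expectation_poisson0_power:
      "measure_pmf.expectation (poisson0_pmf r) (\<lambda>n. q ^ n) = exp (r * (q - 1))"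
  using nn_integral_poisson0_power[OF assms] assms
  by (auto intro: integrableI_nonneg simp: integral_eq_nn_integral)

text \<open>The two elementary moves of a backlog, as operators on functions of it: \<open>arrive r\<close> adds a Poisson
  number of orders, \<open>serve cap\<close> removes what the capacity can process.\<close>

definition arrive :: "real \<Rightarrow> (nat \<Rightarrow> real) \<Rightarrow> nat \<Rightarrow> real" where
  "arrive r g x = measure_pmf.expectation (poisson0_pmf r) (\<lambda>n. g (x + n))"

definition serve :: "nat pmf \<Rightarrow> (nat \<Rightarrow> real) \<Rightarrow> nat \<Rightarrow> real" where
  "serve cap g x = measure_pmf.expectation cap (\<lambda>k. g (x - k))"

lemma integrable_arrive:
  assumes "0 \<le> r" "exp_bounded g"
  shows "integrable (measure_pmf (poisson0_pmf r)) (\<lambda>n. g (x + n))"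
proof -
  obtain C q where g: "1 \<le> q" "0 \<le> C" "\<And>n. \<bar>g n\<bar> \<le> C * q ^ n"
    by (rule exp_boundedE[OF assms(2)]) blast
  show ?thesis
  proof (rule Bochner_Integration.integrable_bound)
    show "integrable (measure_pmf (poisson0_pmf r)) (\<lambda>n. C * q ^ x * q ^ n)"
      using assms(1) g(1) by (intro integrable_mult_right integrable_poisson0_power) auto
    show "AE n in measure_pmf (poisson0_pmf r). norm (g (x + n)) \<le> norm (C * q ^ x * q ^ n)"
      using g by (auto intro!: AE_I2 order_trans[OF g(3)] simp: power_add abs_mult)
  qed simp
qed

text \<open>The backlog after service takes finitely many values only, so capacities with infinite
  mean are covered.\<close>

lemma integrable_serve:
  assumes "exp_bounded g"
  shows "integrable (measure_pmf cap) (\<lambda>k. g (x - k))"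
proof (rule measure_pmf.integrable_const_bound)
  show "AE k in measure_pmf cap. norm (g (x - k)) \<le> Max ((\<lambda>y. \<bar>g y\<bar>) ` {..x})"
    by (intro AE_I2) (auto intro!: Max_ge)
qed simp

lemma averaging_arrive:
  assumes "0 \<le> r"
  shows "averaging (arrive r)"
  unfolding arrive_def[abs_def]
proof (rule averaging_expectation[OF integrable_arrive[OF assms]])
  fix g assume eb: "exp_bounded g"
  then obtain C q where g: "1 \<le> q" "0 \<le> C" "\<And>n. \<bar>g n\<bar> \<le> C * q ^ n"
    by (rule exp_boundedE) blast
  show "exp_bounded (\<lambda>x. measure_pmf.expectation (poisson0_pmf r) (\<lambda>n. g (x + n)))"
  proof (rule exp_boundedI[OF g(1)])
    fix x
    have bound: "\<bar>g (x + n)\<bar> \<le> C * q ^ x * q ^ n" for n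
      using g(3)[of "x + n"] by (simp add: power_add mult.assoc)
    have "\<bar>measure_pmf.expectation (poisson0_pmf r) (\<lambda>n. g (x + n))\<bar>
        \<le> measure_pmf.expectation (poisson0_pmf r) (\<lambda>n. \<bar>g (x + n)\<bar>)"
      by (rule integral_abs_bound)
    also have "\<dots> \<le> measure_pmf.expectation (poisson0_pmf r) (\<lambda>n. C * q ^ x * q ^ n)"
      using assms g(1) bound
      by (intro integral_mono integrable_abs integrable_arrive eb integrable_mult_right
          integrable_poisson0_power) auto
    also have "\<dots> = (C * exp (r * (q - 1))) * q ^ x"
      using assms g(1) by (simp add: expectation_poisson0_power)
    finally show "\<bar>measure_pmf.expectation (poisson0_pmf r) (\<lambda>n. g (x + n))\<bar>
        \<le> (C * exp (r * (q - 1))) * q ^ x" .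
  qed
qed auto

lemma averaging_serve: "averaging (serve cap)"
  unfolding serve_def[abs_def]
proof (rule averaging_expectation[OF integrable_serve])
  fix g assume eb: "exp_bounded g"
  then obtain C q where g: "1 \<le> q" "0 \<le> C" "\<And>n. \<bar>g n\<bar> \<le> C * q ^ n"
    by (rule exp_boundedE) blast
  show "exp_bounded (\<lambda>x. measure_pmf.expectation cap (\<lambda>k. g (x - k)))"
  proof (rule exp_boundedI[OF g(1)])
    fix x
    have "\<bar>measure_pmf.expectation cap (\<lambda>k. g (x - k))\<bar>
        \<le> measure_pmf.expectation cap (\<lambda>k. \<bar>g (x - k)\<bar>)"
      by (rule integral_abs_bound)
    also have "\<dots> \<le> measure_pmf.expectation cap (\<lambda>k. C * q ^ x)"
    proof (intro integral_mono integrable_abs integrable_serve eb)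
      fix k
      have "\<bar>g (x - k)\<bar> \<le> C * q ^ (x - k)" by (rule g(3))
      also have "\<dots> \<le> C * q ^ x" using g by (intro mult_left_mono power_increasing) auto
      finally show "\<bar>g (x - k)\<bar> \<le> C * q ^ x" .
    qed (rule exp_bounded_const)
    finally show "\<bar>measure_pmf.expectation cap (\<lambda>k. g (x - k))\<bar> \<le> C * q ^ x" by simp
  qed
qed auto

text \<open>The superposition of Poisson orders: by the binomial theorem, the sum of two independent Poisson
  numbers is Poisson with the sum of the rates.\<close>

lemma bind_poisson0:
  assumes "0 \<le> r" "0 \<le> s"
  shows "bind_pmf (poisson0_pmf r) (\<lambda>i. map_pmf ((+) i) (poisson0_pmf s)) = poisson0_pmf (r + s)"
proof (rule pmf_eqI)
  fix n
  have m: "pmf (map_pmf ((+) i) (poisson0_pmf s)) n =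
      (if i \<le> n then pmf (poisson0_pmf s) (n - i) else 0)" for i
  proof (cases "i \<le> n")
    case True
    then show ?thesis
      using pmf_map_inj'[of "(+) i" "poisson0_pmf s" "n - i"] by simp
  next
    case False
    then have "n \<notin> set_pmf (map_pmf ((+) i) (poisson0_pmf s))" by auto
    then show ?thesis using False by (simp add: pmf_eq_0_set_pmf)
  qed
  have "pmf (bind_pmf (poisson0_pmf r) (\<lambda>i. map_pmf ((+) i) (poisson0_pmf s))) n =
      (\<Sum>i\<le>n. pmf (poisson0_pmf r) i * pmf (poisson0_pmf s) (n - i))"
    unfolding pmf_bind m
    by (subst integral_measure_pmf[where A="{..n}"]) (auto split: if_splits)
  also have "\<dots> = (\<Sum>i\<le>n. exp (- (r + s)) / fact n * (real (n choose i) * r ^ i * s ^ (n - i)))"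
  proof (intro sum.cong refl)
    fix i assume "i \<in> {..n}"
    then have "real (n choose i) = fact n / (fact i * fact (n - i))"
      by (simp add: binomial_fact)
    moreover have "exp (- (r + s)) = exp (- r) * exp (- s)"
      by (simp add: exp_add[symmetric])
    ultimately show "pmf (poisson0_pmf r) i * pmf (poisson0_pmf s) (n - i) =
        exp (- (r + s)) / fact n * (real (n choose i) * r ^ i * s ^ (n - i))"
      using assms by (simp add: pmf_poisson0)
  qed
  also have "\<dots> = exp (- (r + s)) / fact n * (r + s) ^ n"
    by (simp add: binomial_ring sum_distrib_left)
  finally show "pmf (bind_pmf (poisson0_pmf r) (\<lambda>i. map_pmf ((+) i) (poisson0_pmf s))) n =
      pmf (poisson0_pmf (r + s)) n"
    using assms by (simp add: pmf_poisson0)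
qed

lemma ennreal_arrive:
  assumes "0 \<le> r" "exp_bounded g" "\<And>x. 0 \<le> g x"
  shows "ennreal (arrive r g x) = (\<integral>\<^sup>+n. ennreal (g (x + n)) \<partial>measure_pmf (poisson0_pmf r))"
  unfolding arrive_def using assms
  by (intro nn_integral_eq_integral[symmetric] integrable_arrive) auto

lemma arrive_nonneg: "(\<And>x. 0 \<le> g x) \<Longrightarrow> 0 \<le> arrive r g x"
  unfolding arrive_def by simp

lemma serve_nonneg: "(\<And>x. 0 \<le> g x) \<Longrightarrow> 0 \<le> serve cap g x"
  unfolding serve_def by simp

lemma arrive_arrive:
  assumes "0 \<le> r" "0 \<le> s" "exp_bounded g" "\<And>x. 0 \<le> g x"
  shows "arrive r (arrive s g) = arrive (r + s) g"
proof
  fix x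
  have "ennreal (arrive r (arrive s g) x) =
      (\<integral>\<^sup>+i. \<integral>\<^sup>+j. ennreal (g (x + i + j)) \<partial>measure_pmf (poisson0_pmf s) \<partial>measure_pmf (poisson0_pmf r))"
    using assms
    by (simp add: ennreal_arrive arrive_nonneg averaging_exp_bounded[OF averaging_arrive])
  also have "\<dots> = (\<integral>\<^sup>+n. ennreal (g (x + n)) \<partial>measure_pmf
      (bind_pmf (poisson0_pmf r) (\<lambda>i. map_pmf ((+) i) (poisson0_pmf s))))"
    by (simp add: add.assoc)
  also have "\<dots> = ennreal (arrive (r + s) g x)"
    using assms by (simp only: bind_poisson0) (simp add: ennreal_arrive)
  finally show "arrive r (arrive s g) x = arrive (r + s) g x"
    using assms by (simp add: arrive_nonneg)
qed

lemma arrive_0 [simp]: "arrive 0 g = g"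
  unfolding arrive_def[abs_def] by (simp add: poisson0_pmf_def)

section \<open>Early orders leave a smaller backlog\<close>

lemma strict_mono_arrive:
  assumes "0 \<le> r" "exp_bounded g" "strict_mono g"
  shows "strict_mono (arrive r g)"
proof (rule strict_monoI)
  fix x y :: nat
  assume "x < y"
  moreover obtain i where "i \<in> set_pmf (poisson0_pmf r)"
    using set_pmf_not_empty[of "poisson0_pmf r"] by blast
  ultimately show "arrive r g x < arrive r g y"
    unfolding arrive_def using assms
    by (intro expectation_less integrable_arrive) (auto simp: strict_mono_less strict_mono_less_eq)
qed

text \<open>Strictness survives service because with positive probability there is no capacity at all.\<close>

lemma strict_mono_serve:
  assumes "0 \<in> set_pmf cap" "exp_bounded g" "strict_mono g"
  shows "strict_mono (serve cap g)"
proof (rule strict_monoI)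
  fix x y :: nat
  assume "x < y"
  then show "serve cap g x < serve cap g y"
    unfolding serve_def using assms
    by (intro expectation_less[where i = 0] integrable_serve)
      (auto simp: strict_mono_less strict_mono_less_eq)
qed

lemma expectation_swap:
  fixes f :: "'i \<Rightarrow> 'j \<Rightarrow> real"
  assumes nonneg: "\<And>i j. 0 \<le> f i j"
    and int: "\<And>i. integrable (measure_pmf q) (f i)" "\<And>j. integrable (measure_pmf p) (\<lambda>i. f i j)"
  shows "measure_pmf.expectation p (\<lambda>i. measure_pmf.expectation q (f i)) =
    measure_pmf.expectation q (\<lambda>j. measure_pmf.expectation p (\<lambda>i. f i j))"
proof -
  have q: "(\<integral>\<^sup>+j. ennreal (f i j) \<partial>measure_pmf q) = ennreal (measure_pmf.expectation q (f i))" for i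
    by (rule nn_integral_eq_integral) (use assms in auto)
  have p: "(\<integral>\<^sup>+i. ennreal (f i j) \<partial>measure_pmf p) =
      ennreal (measure_pmf.expectation p (\<lambda>i. f i j))" for j
    by (rule nn_integral_eq_integral) (use assms in auto)
  have "(\<integral>\<^sup>+i. \<integral>\<^sup>+j. ennreal (f i j) \<partial>measure_pmf q \<partial>measure_pmf p) =
      (\<integral>\<^sup>+x. ennreal (f (fst x) (snd x)) \<partial>measure_pmf (pair_pmf p q))"
    by (simp add: nn_integral_pair_pmf')
  also have "\<dots> = (\<integral>\<^sup>+j. \<integral>\<^sup>+i. ennreal (f i j) \<partial>measure_pmf p \<partial>measure_pmf q)"
    by (subst pair_commute_pmf) (simp add: nn_integral_pair_pmf' case_prod_beta)
  finally show ?thesis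
    unfolding q p using nonneg by (simp add: integral_eq_nn_integral)
qed

text \<open>The exchange step. On every realisation, \<open>x + n - k \<le> (x - k) + n\<close>: orders placed before
  the service step can use capacity that would otherwise be lost to the truncation at 0. The
  inequality is strict when \<open>n = 1\<close> and \<open>k = x + 1\<close>, which has positive probability.\<close>

lemma arrive_serve_less_serve_arrive:
  assumes "0 < s" "set_pmf cap = UNIV" "exp_bounded g" "\<And>x. 0 \<le> g x" "strict_mono g"
  shows "arrive s (serve cap g) x < serve cap (arrive s g) x"
proof -
  \<comment> \<open>Service first, arrivals last, with the two expectations interchanged.\<close>
  define F where "F n = measure_pmf.expectation cap (\<lambda>k. g (x - k + n))" for n
  have mono: "y \<le> z \<Longrightarrow> g y \<le> g z" for y z
    using assms(5) by (simp add: strict_mono_less_eq)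
  have int: "integrable (measure_pmf cap) (\<lambda>k. g (x - k + n))" for n
    by (rule measure_pmf.integrable_const_bound[where B = "g (x + n)"])
      (use assms(4) in \<open>auto intro!: mono\<close>)
  have F_le: "F n \<le> g (x + n)" for n
  proof -
    have "F n \<le> measure_pmf.expectation cap (\<lambda>_. g (x + n))"
      unfolding F_def by (intro integral_mono int mono) auto
    then show ?thesis by simp
  qed
  have "serve cap (arrive s g) x = measure_pmf.expectation (poisson0_pmf s) F"
    unfolding serve_def arrive_def F_def
    by (rule expectation_swap) (use assms int in \<open>auto intro!: integrable_arrive\<close>)
  moreover have "arrive s (serve cap g) x < measure_pmf.expectation (poisson0_pmf s) F"
    unfolding arrive_def
  proof (rule expectation_less)
    show "integrable (measure_pmf (poisson0_pmf s)) (\<lambda>n. serve cap g (x + n))"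
      using assms by (intro integrable_arrive averaging_exp_bounded[OF averaging_serve]) auto
    show "integrable (measure_pmf (poisson0_pmf s)) F"
    proof (rule Bochner_Integration.integrable_bound)
      show "integrable (measure_pmf (poisson0_pmf s)) (\<lambda>n. g (x + n))"
        using assms by (intro integrable_arrive) auto
      have "0 \<le> F n" for n unfolding F_def using assms(4) by simp
      then show "AE n in measure_pmf (poisson0_pmf s). norm (F n) \<le> norm (g (x + n))"
        using F_le assms(4) by (intro AE_I2) simp
    qed simp
    show "serve cap g (x + n) \<le> F n" for n
      unfolding F_def serve_def
      by (intro integral_mono integrable_serve int assms) (auto intro!: mono)
    show "1 \<in> set_pmf (poisson0_pmf s)" using assms(1) by (simp add: poisson0_pmf_def)
    show "serve cap g (x + 1) < F 1"
      unfolding F_def serve_def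
    proof (rule expectation_less[where i = "Suc x"])
      show "g (x + 1 - k) \<le> g (x - k + 1)" for k by (rule mono) simp
      show "g (x + 1 - Suc x) < g (x - Suc x + 1)" using assms(5) by (simp add: strict_mono_less)
      show "Suc x \<in> set_pmf cap" by (simp only: assms(2) UNIV_I)
    qed (intro integrable_serve assms(3) int)+
  qed
  ultimately show ?thesis by simp
qed

text \<open>The effect of \<open>n\<close> ages with express rates \<open>r 0, r 1, \<dots>\<close>: applied to the identity and at \<open>n = T\<close>,
  it gives the expected backorders of a cycle as a function of the backlog at its start.\<close>

primrec stages :: "nat pmf \<Rightarrow> (nat \<Rightarrow> real) \<Rightarrow> nat \<Rightarrow> (nat \<Rightarrow> real) \<Rightarrow> nat \<Rightarrow> real" where
  "stages cap r 0 g = g"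
| "stages cap r (Suc n) g = stages cap r n (arrive (r n) (serve cap g))"

text \<open>With \<open>r = lam\<close>, one period of the total backlog.\<close>

definition period :: "nat pmf \<Rightarrow> real \<Rightarrow> (nat \<Rightarrow> real) \<Rightarrow> nat \<Rightarrow> real" where
  "period cap r g = arrive r (serve cap g)"

lemma averaging_period: "0 \<le> r \<Longrightarrow> averaging (period cap r)"
  unfolding period_def[abs_def] by (rule averaging_comp[OF averaging_arrive averaging_serve])

lemma averaging_stages: "(\<And>i. 0 \<le> r i) \<Longrightarrow> averaging (stages cap r n)"
proof (induction n)
  case 0
  show ?case by (simp add: averaging_def)
next
  case (Suc n)
  then show ?case
    using averaging_comp[of "stages cap r n" "period cap (r n)"]
    by (simp add: averaging_period period_def)
qed

text \<open>If the rates \<open>r'\<close> are ahead of the rates \<open>r\<close> at all ages, then after \<open>n\<close> ages the process with the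
  rates \<open>r\<close> still owes orders of the surplus rate \<open>c n\<close>. Adding these orders after the last age
  makes the two totals equal, and this is the statement that can be proved by induction: at each age
  the surplus is pushed past one service step by \<open>arrive_serve_less_serve_arrive\<close>. The first age
  already makes the inequality strict.\<close>

lemma stages_earlier_less:
  assumes cap: "set_pmf cap = UNIV" and nonneg: "\<And>i. 0 \<le> r i" "\<And>i. 0 \<le> r' i"
    and earlier: "\<And>n. n \<le> m \<Longrightarrow> (\<Sum>i<n. r i) \<le> (\<Sum>i<n. r' i)" and first: "r 0 < r' 0"
    and g: "exp_bounded g" "\<And>x. 0 \<le> g x" "strict_mono g" and "0 < n" "n \<le> m"
  shows "stages cap r' n g x < stages cap r n (arrive ((\<Sum>i<n. r' i) - (\<Sum>i<n. r i)) g) x"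
proof -
  define c where "c n = (\<Sum>i<n. r' i) - (\<Sum>i<n. r i)" for n
  have c: "0 \<le> c n" if "n \<le> m" for n using earlier[OF that] by (simp add: c_def)
  have eb: "exp_bounded (arrive r g)" "exp_bounded (serve cap g)"
    if "exp_bounded g" "0 \<le> r" for r g
    using that averagingD(1)[OF averaging_arrive] averagingD(1)[OF averaging_serve] by auto
  have shift: "arrive (c n) (arrive (r' n) (serve cap g)) =
      arrive (r n) (arrive (c (Suc n)) (serve cap g))"
    if "Suc n \<le> m" "exp_bounded g" "\<And>x. 0 \<le> g x" for n g
  proof -
    have "c n + r' n = r n + c (Suc n)" by (simp add: c_def)
    then show ?thesis
      using that c[of n] c[of "Suc n"] nonneg
      by (simp add: arrive_arrive eb[where r = 0] serve_nonneg)
  qed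
  have push: "arrive (c n) (serve cap g) x \<le> serve cap (arrive (c n) g) x"
    if "n \<le> m" "exp_bounded g" "\<And>x. 0 \<le> g x" "strict_mono g" for n x g
    using arrive_serve_less_serve_arrive[OF _ cap that(2-4), of "c n" x] c[OF that(1)]
    by (cases "c n = 0") auto
  from \<open>0 < n\<close> \<open>n \<le> m\<close> g have "stages cap r' n g x < stages cap r n (arrive (c n) g) x"
  proof (induction n arbitrary: g x)
    case 0
    then show ?case by simp
  next
    case (Suc n)
    let ?G = "arrive (r' n) (serve cap g)"
    have G: "exp_bounded ?G" "\<And>x. 0 \<le> ?G x" "strict_mono ?G"
      using Suc.prems nonneg cap
      by (auto intro!: eb arrive_nonneg serve_nonneg strict_mono_arrive strict_mono_serve
          eb[where r = 0])
    have ebs: "exp_bounded (arrive (c (Suc n)) (serve cap g))"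
        "exp_bounded (serve cap (arrive (c (Suc n)) g))"
      using Suc.prems c[of "Suc n"] by (auto intro!: eb eb[where r = 0])
    show ?case
    proof (cases "n = 0")
      case True
      have c1: "0 < c 1" using first by (simp add: c_def)
      have "stages cap r' (Suc n) g x = arrive (r 0) (arrive (c 1) (serve cap g)) x"
        using shift[of 0 g] Suc.prems True by (simp add: c_def)
      also have "\<dots> < arrive (r 0) (serve cap (arrive (c 1) g)) x"
        using ebs True Suc.prems c1 cap nonneg
        by (intro averaging_strict[OF averaging_arrive] arrive_serve_less_serve_arrive) auto
      finally show ?thesis using True by simp
    next
      case False
      have "stages cap r' (Suc n) g x < stages cap r n (arrive (c n) ?G) x"
        using Suc.IH[OF _ _ G] False Suc.prems by simp
      also have "\<dots> = stages cap r n (arrive (r n) (arrive (c (Suc n)) (serve cap g))) x"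
        using shift Suc.prems by simp
      also have "\<dots> \<le> stages cap r n (arrive (r n) (serve cap (arrive (c (Suc n)) g))) x"
        using ebs Suc.prems nonneg c[of "Suc n"]
        by (intro averaging_mono[OF averaging_stages] averaging_mono[OF averaging_arrive]
            push eb) auto
      finally show ?thesis by simp
    qed
  qed
  then show ?thesis by (simp add: c_def)
qed

section \<open>Geometric drift of the total backlog\<close>

text \<open>As a function of \<open>z = 1 / q\<close>, the expectation of \<open>q ^ (D - K)\<close> is 1 at \<open>z = 1\<close> and has there the
  derivative \<open>E K - lam > 0\<close>, so it is below 1 slightly to the left. Since \<open>E K\<close> may be
  infinite, capacities from some \<open>m\<close> on are first replaced by 0; this enlarges the expectation but
  keeps the drift positive when \<open>m\<close> is large.\<close>

lemma exists_geometric_drift: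
  assumes "0 \<le> lam" "ennreal lam < (\<integral>\<^sup>+j. ennreal (real j) \<partial>measure_pmf cap)"
  shows "\<exists>q>1. exp (lam * (q - 1)) * measure_pmf.expectation cap (\<lambda>k. (1 / q) ^ k) < 1"
proof -
  have "(\<integral>\<^sup>+j. ennreal (real j) \<partial>measure_pmf cap) = (\<Sum>j. ennreal (pmf cap j * real j))"
    by (simp add: nn_integral_measure_pmf nn_integral_count_space_nat ennreal_mult')
  also have "\<dots> = (SUP m. \<Sum>j<m. ennreal (pmf cap j * real j))"
    by (rule suminf_eq_SUP)
  finally obtain m where "ennreal lam < (\<Sum>j<m. ennreal (pmf cap j * real j))"
    using assms(2) by (auto simp: less_SUP_iff)
  then have m: "lam < (\<Sum>j<m. pmf cap j * real j)"
    using assms(1) by (subst (asm) sum_ennreal) (auto simp: ennreal_less_iff)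
  define F where "F z = 1 + (\<Sum>j<m. pmf cap j * (z ^ j - 1))" for z :: real
  define G where "G z = exp (lam * (1 / z - 1)) * F z" for z
  have F': "(F has_real_derivative (\<Sum>j<m. pmf cap j * real j)) (at 1)"
    unfolding F_def by (auto intro!: derivative_eq_intros simp: mult.commute)
  have "(G has_real_derivative ((\<Sum>j<m. pmf cap j * real j) - lam)) (at 1)"
    unfolding G_def by (auto intro!: derivative_eq_intros F') (simp add: F_def)
  with m obtain d where d: "0 < d" "\<And>h. 0 < h \<Longrightarrow> h < d \<Longrightarrow> G (1 - h) < G 1"
    using DERIV_pos_inc_left[of G "(\<Sum>j<m. pmf cap j * real j) - lam" 1] by auto
  define z where "z = 1 - min (d / 2) (1 / 2)"
  have z: "0 < z" "z < 1" "G z < 1"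
    using d(1) d(2)[of "min (d / 2) (1 / 2)"] by (auto simp: z_def G_def F_def)
  have "measure_pmf.expectation cap (\<lambda>k. z ^ k) \<le>
      measure_pmf.expectation cap (\<lambda>k. 1 + (if k < m then z ^ k - 1 else 0))"
    using z by (intro integral_mono measure_pmf.integrable_const_bound[where B = 1])
      (auto simp: power_le_one)
  also have "\<dots> = 1 + measure_pmf.expectation cap (\<lambda>k. if k < m then z ^ k - 1 else 0)"
    using z by (subst Bochner_Integration.integral_add)
      (auto intro!: measure_pmf.integrable_const_bound[where B = 1] simp: power_le_one)
  also have "measure_pmf.expectation cap (\<lambda>k. if k < m then z ^ k - 1 else 0) =
      (\<Sum>j<m. pmf cap j * (z ^ j - 1))"
    by (subst integral_measure_pmf[where A = "{..<m}"]) (auto split: if_splits)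
  finally have "measure_pmf.expectation cap (\<lambda>k. z ^ k) \<le> F z" by (simp add: F_def)
  then have "exp (lam * (1 / z - 1)) * measure_pmf.expectation cap (\<lambda>k. z ^ k) \<le> G z"
    unfolding G_def by (intro mult_left_mono) auto
  with z show ?thesis by (intro exI[of _ "1 / z"]) auto
qed

text \<open>The Lipschitz condition for the distance \<open>\<bar>q ^ x - q ^ y\<bar>\<close>. This distance, and not
  \<open>\<bar>x - y\<bar>\<close>, is contracted by a period: truncation at 0 never increases it, and without truncation
  it is multiplied by \<open>q ^ (D - K)\<close>.\<close>

definition geo_lipschitz :: "real \<Rightarrow> real \<Rightarrow> (nat \<Rightarrow> real) \<Rightarrow> bool" where
  "geo_lipschitz q c g \<longleftrightarrow> (\<forall>x y. y \<le> x \<longrightarrow> \<bar>g x - g y\<bar> \<le> c * (q ^ x - q ^ y))"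

text \<open>Bernoulli's inequality.\<close>

lemma geo_lipschitz_real:
  assumes "1 < q"
  shows "geo_lipschitz q (1 / (q - 1)) real"
  unfolding geo_lipschitz_def
proof (intro allI impI)
  fix x y :: nat
  assume "y \<le> x"
  have "real (x - y) * (q - 1) \<le> q ^ (x - y) - 1"
    using Bernoulli_inequality[of "q - 1" "x - y"] assms by simp
  also have "\<dots> = 1 * (q ^ (x - y) - 1)" by simp
  also have "\<dots> \<le> q ^ y * (q ^ (x - y) - 1)"
    using assms by (intro mult_right_mono) auto
  also have "\<dots> = q ^ x - q ^ y"
    using \<open>y \<le> x\<close> by (simp add: algebra_simps power_add[symmetric])
  finally show "\<bar>real x - real y\<bar> \<le> 1 / (q - 1) * (q ^ x - q ^ y)"
    using assms \<open>y \<le> x\<close> by (simp add: field_simps of_nat_diff)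
qed

lemma geo_lipschitz_arrive:
  assumes "0 \<le> r" "1 \<le> q" "exp_bounded g" "geo_lipschitz q c g"
  shows "geo_lipschitz q (c * exp (r * (q - 1))) (arrive r g)"
  unfolding geo_lipschitz_def
proof (intro allI impI)
  fix x y :: nat
  assume "y \<le> x"
  let ?p = "measure_pmf (poisson0_pmf r)"
  have "\<bar>arrive r g x - arrive r g y\<bar> = \<bar>\<integral>n. g (x + n) - g (y + n) \<partial>?p\<bar>"
    unfolding arrive_def using assms by (subst Bochner_Integration.integral_diff) (auto intro: integrable_arrive)
  also have "\<dots> \<le> (\<integral>n. \<bar>g (x + n) - g (y + n)\<bar> \<partial>?p)"
    by (rule integral_abs_bound)
  also have "\<dots> \<le> (\<integral>n. (c * (q ^ x - q ^ y)) * q ^ n \<partial>?p)"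
  proof (rule integral_mono)
    fix n
    have "\<bar>g (x + n) - g (y + n)\<bar> \<le> c * (q ^ (x + n) - q ^ (y + n))"
      using assms(4) \<open>y \<le> x\<close> by (simp add: geo_lipschitz_def)
    then show "\<bar>g (x + n) - g (y + n)\<bar> \<le> (c * (q ^ x - q ^ y)) * q ^ n"
      by (simp add: power_add algebra_simps)
  qed (use assms in \<open>auto intro!: integrable_arrive integrable_poisson0_power\<close>)
  also have "\<dots> = c * exp (r * (q - 1)) * (q ^ x - q ^ y)"
    using assms by (simp add: expectation_poisson0_power)
  finally show "\<bar>arrive r g x - arrive r g y\<bar> \<le> c * exp (r * (q - 1)) * (q ^ x - q ^ y)" .
qed

lemma power_diff_le:
  assumes "1 \<le> q"
  shows "q ^ (x - k) \<le> (1 / q) ^ k * q ^ x + (1::real)"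
proof (cases "k \<le> x")
  case True
  then show ?thesis using assms by (simp add: power_diff power_divide)
next
  case False
  then show ?thesis using assms by simp
qed

lemma power_diff_contract:
  assumes "1 \<le> q" "y \<le> x"
  shows "q ^ (x - k) - q ^ (y - k) \<le> (1 / q) ^ k * (q ^ x - q ^ (y::nat) :: real)"
proof -
  have q: "0 < q ^ k" using assms by simp
  consider "k \<le> y" | "y < k" "k \<le> x" | "x < k" by linarith
  then show ?thesis
  proof cases
    case 1
    then show ?thesis using assms by (simp add: power_diff power_divide diff_divide_distrib)
  next
    case 2
    then have "q ^ y \<le> q ^ k" using assms by (intro power_increasing) auto
    then show ?thesis using 2 assms q by (simp add: power_diff power_divide field_simps)
  next
    case 3
    then show ?thesis using assms by (simp add: power_increasing)
  qed
qed

lemma geo_lipschitz_serve: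
  assumes "1 \<le> q" "0 \<le> c" "exp_bounded g" "geo_lipschitz q c g"
  shows "geo_lipschitz q (c * measure_pmf.expectation cap (\<lambda>k. (1 / q) ^ k)) (serve cap g)"
  unfolding geo_lipschitz_def
proof (intro allI impI)
  fix x y :: nat
  assume "y \<le> x"
  have "\<bar>serve cap g x - serve cap g y\<bar> = \<bar>measure_pmf.expectation cap (\<lambda>k. g (x - k) - g (y - k))\<bar>"
    unfolding serve_def using assms by (subst Bochner_Integration.integral_diff) (auto intro: integrable_serve)
  also have "\<dots> \<le> measure_pmf.expectation cap (\<lambda>k. \<bar>g (x - k) - g (y - k)\<bar>)"
    by (rule integral_abs_bound)
  also have "\<dots> \<le> measure_pmf.expectation cap (\<lambda>k. (c * (q ^ x - q ^ y)) * (1 / q) ^ k)"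
  proof (rule integral_mono)
    fix k
    have "\<bar>g (x - k) - g (y - k)\<bar> \<le> c * (q ^ (x - k) - q ^ (y - k))"
      using assms(4) \<open>y \<le> x\<close> by (simp add: geo_lipschitz_def)
    also have "\<dots> \<le> c * ((1 / q) ^ k * (q ^ x - q ^ y))"
      using assms \<open>y \<le> x\<close> by (intro mult_left_mono power_diff_contract) auto
    finally show "\<bar>g (x - k) - g (y - k)\<bar> \<le> (c * (q ^ x - q ^ y)) * (1 / q) ^ k"
      by (simp add: algebra_simps)
  next
    show "integrable (measure_pmf cap) (\<lambda>k. (c * (q ^ x - q ^ y)) * (1 / q) ^ k)"
      using assms(1)
      by (intro integrable_mult_right measure_pmf.integrable_const_bound[where B = 1])
        (auto simp: power_le_one)
  qed (use assms in \<open>auto intro!: integrable_serve\<close>)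
  also have "\<dots> = c * measure_pmf.expectation cap (\<lambda>k. (1 / q) ^ k) * (q ^ x - q ^ y)"
    by simp
  finally show "\<bar>serve cap g x - serve cap g y\<bar> \<le>
      c * measure_pmf.expectation cap (\<lambda>k. (1 / q) ^ k) * (q ^ x - q ^ y)" .
qed

text \<open>At high rates the constant may grow; the contraction that the long run needs comes from the periods
  of the total backlog.\<close>

lemma geo_lipschitz_stages:
  assumes q: "1 \<le> q" and r: "\<And>i. 0 \<le> r i"
    and "exp_bounded g" "0 \<le> c" "geo_lipschitz q c g"
  shows "\<exists>c\<ge>0. geo_lipschitz q c (stages cap r n g)"
  using assms(3-)
proof (induction n arbitrary: g c)
  case 0
  then show ?case by auto
next
  case (Suc n)
  let ?\<psi> = "measure_pmf.expectation cap (\<lambda>k. (1 / q) ^ k)"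
  have "0 \<le> ?\<psi>" using q by simp
  then show ?case
    using Suc.prems q r
    by (auto intro!: Suc.IH[where c = "c * ?\<psi> * exp (r n * (q - 1))"] geo_lipschitz_arrive
        geo_lipschitz_serve averaging_exp_bounded[OF averaging_arrive]
        averaging_exp_bounded[OF averaging_serve])
qed

text \<open>A total backlog with demand rate \<open>lam\<close>, together with a base \<open>q\<close> as found in
  \<open>exists_geometric_drift\<close>.\<close>

locale geometric_drift =
  fixes cap :: "nat pmf" and lam q :: real
  assumes lam: "0 \<le> lam" and q: "1 < q"
    and drift: "exp (lam * (q - 1)) * measure_pmf.expectation cap (\<lambda>k. (1 / q) ^ k) < 1"
begin

definition phi :: real where
  "phi = exp (lam * (q - 1)) * measure_pmf.expectation cap (\<lambda>k. (1 / q) ^ k)"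

lemma phi: "0 \<le> phi" "phi < 1"
  using drift q by (auto simp: phi_def)

lemma averaging_periods: "averaging (period cap lam ^^ t)"
  by (intro averaging_funpow averaging_period lam)

lemma averaging_one_period: "averaging (period cap lam)"
  using averaging_periods[of 1] by simp

lemma period_power_le: "period cap lam (\<lambda>n. q ^ n) x \<le> phi * q ^ x + 1"
proof -
  let ?\<psi> = "measure_pmf.expectation cap (\<lambda>k. (1 / q) ^ k)"
  note eb = exp_bounded_power[OF less_imp_le[OF q]]
  have int: "integrable (measure_pmf cap) (\<lambda>k. (1 / q) ^ k * q ^ y)" for y
    using q by (intro integrable_mult_left measure_pmf.integrable_const_bound[where B = 1])
      (auto simp: power_le_one)
  have "serve cap (\<lambda>n. q ^ n) y \<le> ?\<psi> * q ^ y + 1" for y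
  proof -
    have "serve cap (\<lambda>n. q ^ n) y \<le> measure_pmf.expectation cap (\<lambda>k. (1 / q) ^ k * q ^ y + 1)"
      unfolding serve_def using q int power_diff_le[of q y]
      by (intro integral_mono integrable_serve eb) auto
    also have "\<dots> = ?\<psi> * q ^ y + 1"
      using int by simp
    finally show ?thesis .
  qed
  then have "period cap lam (\<lambda>n. q ^ n) x \<le> arrive lam (\<lambda>y. ?\<psi> * q ^ y + 1) x"
    unfolding period_def
    by (intro averaging_mono[OF averaging_arrive[OF lam]] eb
        averaging_exp_bounded[OF averaging_serve]
        exp_bounded_linear[OF eb exp_bounded_const, of _ 1 1, simplified]) auto
  also have "\<dots> = ?\<psi> * arrive lam (\<lambda>n. q ^ n) x + 1"
    by (simp add: averaging_affine'[OF averaging_arrive[OF lam] eb])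
  also have "arrive lam (\<lambda>n. q ^ n) x = exp (lam * (q - 1)) * q ^ x"
    using q lam by (simp add: arrive_def power_add expectation_poisson0_power)
  finally show ?thesis by (simp add: phi_def mult_ac)
qed

text \<open>The Lyapunov function stays bounded in expectation, uniformly in time: this is the tightness of the
  total backlog.\<close>

lemma periods_power_le: "(period cap lam ^^ t) (\<lambda>n. q ^ n) x \<le> q ^ x + 1 / (1 - phi)"
proof (induction t)
  case 0
  then show ?case using phi by simp
next
  case (Suc t)
  note eb = exp_bounded_power[OF less_imp_le[OF q]]
  have "(period cap lam ^^ Suc t) (\<lambda>n. q ^ n) x = (period cap lam ^^ t) (period cap lam (\<lambda>n. q ^ n)) x"
    by (simp add: funpow_swap1)
  also have "\<dots> \<le> (period cap lam ^^ t) (\<lambda>n. phi * q ^ n + 1) x"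
    using averaging_exp_bounded[OF averaging_one_period eb]
      exp_bounded_linear[OF eb exp_bounded_const, of phi 1 1]
    by (intro averaging_mono[OF averaging_periods] period_power_le) auto
  also have "\<dots> = phi * (period cap lam ^^ t) (\<lambda>n. q ^ n) x + 1"
    by (simp add: averaging_affine'[OF averaging_periods eb])
  also have "\<dots> \<le> phi * (q ^ x + 1 / (1 - phi)) + 1"
    using Suc phi by (intro add_mono mult_left_mono) auto
  also have "\<dots> = phi * q ^ x + 1 / (1 - phi)"
    using phi by (simp add: field_simps)
  also have "\<dots> \<le> q ^ x + 1 / (1 - phi)"
    using phi q by (simp add: mult_left_le_one_le)
  finally show ?case .
qed

lemma geo_lipschitz_periods:
  assumes "exp_bounded g" "0 \<le> c" "geo_lipschitz q c g"
  shows "geo_lipschitz q (c * phi ^ t) ((period cap lam ^^ t) g)"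
proof (induction t)
  case 0
  then show ?case using assms by simp
next
  case (Suc t)
  let ?\<psi> = "measure_pmf.expectation cap (\<lambda>k. (1 / q) ^ k)"
  have "geo_lipschitz q (c * phi ^ t * ?\<psi> * exp (lam * (q - 1))) (period cap lam ((period cap lam ^^ t) g))"
    unfolding period_def[of cap lam "(period cap lam ^^ t) g"] using assms Suc phi q lam
    by (intro geo_lipschitz_arrive geo_lipschitz_serve averaging_exp_bounded[OF averaging_serve]
        averaging_exp_bounded[OF averaging_periods]) auto
  then show ?case by (simp add: phi_def mult_ac)
qed

text \<open>The step from time \<open>t\<close> to \<open>t + 1\<close> amounts to averaging the differences of the \<open>t\<close>-th iterate
  between the start \<open>x\<close> and the state one period later. They are of order \<open>phi ^ t\<close>, which is summable.\<close>

lemma periods_convergent: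
  assumes "exp_bounded g" "0 \<le> c" "geo_lipschitz q c g"
  shows "convergent (\<lambda>t. (period cap lam ^^ t) g x)"
proof -
  define u where "u t = (period cap lam ^^ t) g" for t
  define B where "B = period cap lam (\<lambda>n. q ^ n) x + q ^ x"
  note eb = exp_bounded_power[OF less_imp_le[OF q]]
  have u: "exp_bounded (u t)" for t
    unfolding u_def by (rule averaging_exp_bounded[OF averaging_periods assms(1)])
  have dist: "\<bar>u t y - u t z\<bar> \<le> c * phi ^ t * (q ^ y + q ^ z)" for t y z
  proof -
    have c: "0 \<le> c * phi ^ t" using assms(2) phi by simp
    have *: "\<bar>u t y - u t z\<bar> \<le> c * phi ^ t * (q ^ y + q ^ z)" if "z \<le> y" for y z
    proof -
      have "\<bar>u t y - u t z\<bar> \<le> c * phi ^ t * (q ^ y - q ^ z)"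
        using geo_lipschitz_periods[OF assms, of t] that by (simp add: geo_lipschitz_def u_def)
      also have "\<dots> \<le> c * phi ^ t * (q ^ y + q ^ z)"
        using q by (intro mult_left_mono c) auto
      finally show ?thesis .
    qed
    show ?thesis
      using *[of z y] *[of y z] by (cases "z \<le> y") (auto simp: abs_minus_commute add.commute)
  qed
  have aff: "exp_bounded (\<lambda>y. b * q ^ y + a)" for a b
    using exp_bounded_linear[OF eb exp_bounded_const, of b 1 a] by simp
  have diff: "\<bar>u (Suc t) x - u t x\<bar> \<le> c * B * phi ^ t" for t
  proof -
    define k where "k = c * phi ^ t"
    have "u (Suc t) x \<le> period cap lam (\<lambda>y. k * q ^ y + (u t x + k * q ^ x)) x"
      unfolding u_def[of "Suc t"] funpow.simps o_def u_def[of t, symmetric]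
      by (intro averaging_mono[OF averaging_one_period] u aff)
        (use dist[of t _ x] in \<open>auto simp: k_def abs_le_iff algebra_simps\<close>)
    moreover have "period cap lam (\<lambda>y. - k * q ^ y + (u t x - k * q ^ x)) x \<le> u (Suc t) x"
      unfolding u_def[of "Suc t"] funpow.simps o_def u_def[of t, symmetric]
      by (intro averaging_mono[OF averaging_one_period] u aff)
        (use dist[of t _ x] in \<open>auto simp: k_def abs_le_iff algebra_simps\<close>)
    ultimately have "\<bar>u (Suc t) x - u t x\<bar> \<le> k * B"
      unfolding averaging_affine'[OF averaging_one_period eb] B_def
      by (simp add: abs_le_iff algebra_simps)
    then show ?thesis by (simp add: k_def mult_ac)
  qed
  have "summable (\<lambda>t. u (Suc t) x - u t x)"
  proof (rule summable_comparison_test'[OF summable_mult])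
    show "summable (\<lambda>t. phi ^ t)" using phi by (simp add: summable_geometric)
    show "norm (u (Suc t) x - u t x) \<le> c * B * phi ^ t" if "0 \<le> t" for t using diff by simp
  qed
  then have "convergent (\<lambda>n. u n x - u 0 x)"
    unfolding summable_iff_convergent by (simp add: sum_lessThan_telescope[of "\<lambda>t. u t x"])
  then have "convergent (\<lambda>n. (u n x - u 0 x) + u 0 x)"
    by (intro convergent_add convergent_const)
  then show ?thesis by (simp add: u_def)
qed

text \<open>The gap \<open>h - g\<close> is positive everywhere but may tend to 0 at infinity. It is at least \<open>d > 0\<close> on
  a finite set of states \<open>{..m}\<close>, where the backlog spends at least half of its mass by Markov's
  inequality; in operator form, \<open>h - g\<close> is bounded below by a multiple of \<open>1 - q ^ y / q ^ m\<close>.\<close>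

lemma periods_gap:
  assumes "exp_bounded g" "exp_bounded h" "\<And>x. g x < h x"
  shows "\<exists>\<epsilon>>0. \<forall>t. (period cap lam ^^ t) g x + \<epsilon> \<le> (period cap lam ^^ t) h x"
proof -
  define A where "A = q ^ x + 1 / (1 - phi)"
  have A: "0 < A" using q phi by (simp add: A_def add_pos_pos)
  \<comment> \<open>The bound \<open>A\<close> on the expectation of the Lyapunov function determines a level that the backlog
    exceeds with probability below one half.\<close>
  obtain m where m: "2 * A < q ^ m" using real_arch_pow[OF q] by blast
  define d where "d = Min ((\<lambda>y. h y - g y) ` {..m})"
  have d: "0 < d" "\<And>y. y \<le> m \<Longrightarrow> d \<le> h y - g y"
    using assms(3) by (auto simp: d_def)
  note eb = exp_bounded_power[OF less_imp_le[OF q]]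
  define b where "b = d / q ^ m"
  have b: "0 \<le> b" "b * q ^ m = d" "b * A \<le> d / 2"
    using d(1) m q A by (auto simp: b_def field_simps)
  have below: "g y + (- b * q ^ y + d) \<le> h y" for y
  proof (cases "y \<le> m")
    case True
    have "0 \<le> b * q ^ y" using b(1) q by simp
    with d(2)[OF True] show ?thesis by simp
  next
    case False
    then have "b * q ^ m \<le> b * q ^ y"
      using b(1) q by (intro mult_left_mono power_increasing) auto
    then show ?thesis using b(2) assms(3)[of y] by simp
  qed
  have "(period cap lam ^^ t) g x + d / 2 \<le> (period cap lam ^^ t) h x" for t
  proof -
    have eb': "exp_bounded (\<lambda>y. g y + (- b * q ^ y + d))"
      using exp_bounded_linear[OF assms(1) exp_bounded_linear[OF eb exp_bounded_const, of "- b" 1 d],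
        of 1 1] by simp
    have "b * (period cap lam ^^ t) (\<lambda>n. q ^ n) x \<le> b * A"
      using periods_power_le[of t x] b(1) by (intro mult_left_mono) (auto simp: A_def)
    then have "(period cap lam ^^ t) g x + d / 2 \<le>
        (period cap lam ^^ t) g x + (- b * (period cap lam ^^ t) (\<lambda>n. q ^ n) x + d)"
      using b(3) by simp
    also have "\<dots> = (period cap lam ^^ t) (\<lambda>y. g y + (- b * q ^ y + d)) x"
      by (simp only: averaging_affine[OF averaging_periods assms(1) eb])
    also have "\<dots> \<le> (period cap lam ^^ t) h x"
      by (rule averaging_mono[OF averaging_periods eb' assms(2) below])
    finally show ?thesis .
  qed
  then show ?thesis using d(1) by (intro exI[of _ "d / 2"]) auto
qed

end

section \<open>From the shipment process to the operators\<close>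

text \<open>Rate 0 after the cutoff point, so that one Poisson law covers all ages.\<close>

definition express_rate :: "real \<Rightarrow> real \<Rightarrow> real \<Rightarrow> policy \<Rightarrow> nat \<Rightarrow> real" where
  "express_rate lam Umin Umax \<pi> \<tau> =
     (if \<tau> \<le> cutoff \<pi> then express_share Umin Umax (fee \<pi> \<tau>) * lam else 0)"

lemma express_law_rate:
  "express_law lam Umin Umax \<pi> \<tau> = poisson0_pmf (express_rate lam Umin Umax \<pi> \<tau>)"
  by (simp add: express_law_def express_rate_def poisson0_pmf_def)

lemma regular_law_rate:
  "regular_law lam Umin Umax \<pi> \<tau> = poisson0_pmf (lam - express_rate lam Umin Umax \<pi> \<tau>)"
  by (simp add: regular_law_def express_rate_def left_diff_distrib)

lemma express_rate_bounds:
  assumes "\<pi> \<in> policies T Umin Umax" "Umin < Umax" "0 \<le> lam"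
  shows "0 \<le> express_rate lam Umin Umax \<pi> \<tau>" "express_rate lam Umin Umax \<pi> \<tau> \<le> lam"
proof -
  have "fee \<pi> \<tau> \<in> {Umin..Umax}" if "\<tau> \<le> cutoff \<pi>"
  proof -
    have "fee \<pi> \<tau> \<in> set (snd \<pi>)" "set (snd \<pi>) \<subseteq> {Umin..Umax}"
      using assms(1) that by (auto simp: policies_def)
    then show ?thesis by blast
  qed
  then have "0 \<le> express_share Umin Umax (fee \<pi> \<tau>)" "express_share Umin Umax (fee \<pi> \<tau>) \<le> 1"
    if "\<tau> \<le> cutoff \<pi>"
    using assms(2) that by (auto simp: express_share_def divide_le_eq)
  then show "0 \<le> express_rate lam Umin Umax \<pi> \<tau>" "express_rate lam Umin Umax \<pi> \<tau> \<le> lam"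
    using assms(3) by (auto simp: express_rate_def mult_left_le_one_le)
qed

context shipment_process
begin

definition input :: "source \<times> nat \<Rightarrow> 'a \<Rightarrow> nat" where
  "input = (\<lambda>(s, t). case s of Express \<Rightarrow> E t | Regular \<Rightarrow> N t | Capacity \<Rightarrow> K t)"

lemma input_simps [simp]:
  "input (Express, t) = E t" "input (Regular, t) = N t" "input (Capacity, t) = K t"
  by (simp_all add: input_def)

text \<open>To be a function of the inputs with indices in \<open>J\<close>. Independence is used only in the form that a
  variable determined by \<open>J\<close> is independent of every input outside \<open>J\<close>.\<close>

definition determined_by :: "(source \<times> nat) set \<Rightarrow> ('a \<Rightarrow> nat) \<Rightarrow> bool" where
  "determined_by J X \<longleftrightarrow>
     (\<exists>F \<in> measurable (PiM J (\<lambda>_. count_space UNIV)) (count_space UNIV).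
        \<forall>\<omega>. X \<omega> = F (restrict (\<lambda>i. input i \<omega>) J))"

lemma determined_by_const: "determined_by J (\<lambda>_. c)"
  unfolding determined_by_def by (intro bexI[of _ "\<lambda>_. c"]) auto

lemma determined_by_input: "i \<in> J \<Longrightarrow> determined_by J (input i)"
  unfolding determined_by_def
  by (intro bexI[of _ "\<lambda>x. x i"] measurable_component_singleton) auto

lemma determined_by_superset:
  assumes "determined_by J X" "J \<subseteq> J'"
  shows "determined_by J' X"
proof -
  obtain F where F: "F \<in> measurable (PiM J (\<lambda>_. count_space UNIV)) (count_space UNIV)"
      "\<And>\<omega>. X \<omega> = F (restrict (\<lambda>i. input i \<omega>) J)"
    using assms(1) unfolding determined_by_def by blast
  have "restrict (restrict (\<lambda>i. input i \<omega>) J') J = restrict (\<lambda>i. input i \<omega>) J" for \<omega>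
    using assms(2) by (auto simp: restrict_def fun_eq_iff)
  then show ?thesis
    unfolding determined_by_def using F assms(2)
    by (intro bexI[of _ "\<lambda>x. F (restrict x J)"]
        measurable_compose[OF measurable_restrict_subset F(1)]) auto
qed

lemma determined_by_binop:
  assumes "determined_by J X" "determined_by J Y"
  shows "determined_by J (\<lambda>\<omega>. f (X \<omega>) (Y \<omega>))"
proof -
  obtain F where F: "F \<in> measurable (PiM J (\<lambda>_. count_space UNIV)) (count_space UNIV)"
      "\<And>\<omega>. X \<omega> = F (restrict (\<lambda>i. input i \<omega>) J)"
    using assms(1) unfolding determined_by_def by blast
  obtain G where G: "G \<in> measurable (PiM J (\<lambda>_. count_space UNIV)) (count_space UNIV)"
      "\<And>\<omega>. Y \<omega> = G (restrict (\<lambda>i. input i \<omega>) J)"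
    using assms(2) unfolding determined_by_def by blast
  have "(\<lambda>x. f (F x) (G x)) \<in> measurable (PiM J (\<lambda>_. count_space UNIV)) (count_space UNIV)"
    by (rule measurable_compose_countable[OF measurable_compose[OF G(1)] F(1)]) simp
  then show ?thesis
    unfolding determined_by_def using F(2) G(2) by (intro bexI[of _ "\<lambda>x. f (F x) (G x)"]) auto
qed

text \<open>An input that has not been used before may be integrated out first, the rest being held
  fixed: Fubini's theorem for the joint law, which is a product.\<close>

lemma expectation_fresh_input:
  fixes f :: "nat \<Rightarrow> nat \<Rightarrow> real"
  assumes X: "determined_by J X" "i \<notin> J" and Z: "distr M (count_space UNIV) (input i) = measure_pmf p"
    and f: "\<And>x y. 0 \<le> f x y" "\<And>x. integrable (measure_pmf p) (f x)"
  shows "expectation (\<lambda>\<omega>. f (X \<omega>) (input i \<omega>)) =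
    expectation (\<lambda>\<omega>. measure_pmf.expectation p (f (X \<omega>)))"
proof -
  let ?C = "count_space (UNIV :: nat set)"
  obtain F where F: "F \<in> measurable (PiM J (\<lambda>_. count_space UNIV)) (count_space UNIV)"
      "\<And>\<omega>. X \<omega> = F (restrict (\<lambda>i. input i \<omega>) J)"
    using X(1) unfolding determined_by_def by blast
  have "indep_vars (\<lambda>_. ?C) input UNIV"
    using indep by (simp add: input_def)
  then have "indep_var (PiM J (\<lambda>_. ?C)) (\<lambda>\<omega>. restrict (\<lambda>i. input i \<omega>) J)
      (PiM {i} (\<lambda>_. ?C)) (\<lambda>\<omega>. restrict (\<lambda>i. input i \<omega>) {i})"
    by (rule indep_var_restrict) (use X(2) in auto)
  then have "indep_var ?C (F \<circ> (\<lambda>\<omega>. restrict (\<lambda>i. input i \<omega>) J))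
      ?C ((\<lambda>x. x i) \<circ> (\<lambda>\<omega>. restrict (\<lambda>i. input i \<omega>) {i}))"
    by (rule indep_var_compose[OF _ F(1)]) (rule measurable_component_singleton, simp)
  moreover have "F \<circ> (\<lambda>\<omega>. restrict (\<lambda>i. input i \<omega>) J) = X"
    using F(2) by (simp add: fun_eq_iff)
  moreover have "(\<lambda>x. x i) \<circ> (\<lambda>\<omega>. restrict (\<lambda>i. input i \<omega>) {i}) = input i"
    by (simp add: fun_eq_iff)
  ultimately have iv: "indep_var ?C X ?C (input i)" by simp
  then have rv: "X \<in> measurable M ?C" "input i \<in> measurable M ?C"
    and joint: "distr M (?C \<Otimes>\<^sub>M ?C) (\<lambda>\<omega>. (X \<omega>, input i \<omega>)) = distr M ?C X \<Otimes>\<^sub>M measure_pmf p"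
    unfolding indep_var_distribution_eq Z by auto
  have C2: "?C \<Otimes>\<^sub>M ?C = count_space UNIV"
    by (simp add: pair_measure_countable)
  have rv2: "(\<lambda>\<omega>. (X \<omega>, input i \<omega>)) \<in> measurable M (?C \<Otimes>\<^sub>M ?C)"
    using rv by simp
  have "(\<integral>\<^sup>+\<omega>. ennreal (f (X \<omega>) (input i \<omega>)) \<partial>M) =
      (\<integral>\<^sup>+z. ennreal (f (fst z) (snd z)) \<partial>distr M (?C \<Otimes>\<^sub>M ?C) (\<lambda>\<omega>. (X \<omega>, input i \<omega>)))"
    by (subst nn_integral_distr[OF rv2]) (simp_all add: C2)
  also have "\<dots> = (\<integral>\<^sup>+x. \<integral>\<^sup>+y. ennreal (f x y) \<partial>measure_pmf p \<partial>distr M ?C X)"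
  proof -
    have "sets (distr M ?C X \<Otimes>\<^sub>M measure_pmf p) = sets (?C \<Otimes>\<^sub>M ?C)"
      by (intro sets_pair_measure_cong) auto
    then have s: "sets (distr M ?C X \<Otimes>\<^sub>M measure_pmf p) = sets (count_space UNIV)"
      unfolding C2 .
    have "(\<lambda>z. ennreal (f (fst z) (snd z))) \<in> borel_measurable (distr M ?C X \<Otimes>\<^sub>M measure_pmf p)"
      unfolding measurable_cong_sets[OF s refl] by simp
    from measure_pmf.nn_integral_fst[OF this] show ?thesis
      unfolding joint by simp
  qed
  also have "\<dots> = (\<integral>\<^sup>+\<omega>. \<integral>\<^sup>+y. ennreal (f (X \<omega>) y) \<partial>measure_pmf p \<partial>M)"
    by (subst nn_integral_distr[OF rv(1)]) simp_all
  also have "\<dots> = (\<integral>\<^sup>+\<omega>. ennreal (measure_pmf.expectation p (f (X \<omega>))) \<partial>M)"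
    using f by (intro nn_integral_cong nn_integral_eq_integral) auto
  finally have eq: "(\<integral>\<^sup>+\<omega>. ennreal (f (X \<omega>) (input i \<omega>)) \<partial>M) =
      (\<integral>\<^sup>+\<omega>. ennreal (measure_pmf.expectation p (f (X \<omega>))) \<partial>M)" .
  have m1: "(\<lambda>\<omega>. f (X \<omega>) (input i \<omega>)) \<in> borel_measurable M"
    using measurable_compose[OF rv2, of "\<lambda>z. f (fst z) (snd z)" borel] by (simp add: C2)
  have m2: "(\<lambda>\<omega>. measure_pmf.expectation p (f (X \<omega>))) \<in> borel_measurable M"
    using measurable_compose[OF rv(1), of "\<lambda>x. measure_pmf.expectation p (f x)" borel] by simp
  have "expectation (\<lambda>\<omega>. f (X \<omega>) (input i \<omega>)) =
      enn2real (\<integral>\<^sup>+\<omega>. ennreal (f (X \<omega>) (input i \<omega>)) \<partial>M)"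
    by (rule integral_eq_nn_integral[OF m1]) (simp add: f(1))
  moreover have "expectation (\<lambda>\<omega>. measure_pmf.expectation p (f (X \<omega>))) =
      enn2real (\<integral>\<^sup>+\<omega>. ennreal (measure_pmf.expectation p (f (X \<omega>))) \<partial>M)"
    by (rule integral_eq_nn_integral[OF m2]) (simp add: f(1))
  ultimately show ?thesis by (simp only: eq)
qed

lemma expectation_arrive:
  assumes "determined_by J X" "i \<notin> J" "distr M (count_space UNIV) (input i) = measure_pmf (poisson0_pmf r)"
    and "0 \<le> r" "exp_bounded g" "\<And>x. 0 \<le> g x"
  shows "expectation (\<lambda>\<omega>. g (X \<omega> + input i \<omega>)) = expectation (\<lambda>\<omega>. arrive r g (X \<omega>))"
  using expectation_fresh_input[OF assms(1-3), of "\<lambda>x n. g (x + n)"] assms(4-)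
  by (simp add: arrive_def integrable_arrive)

lemma expectation_serve:
  assumes "determined_by J X" "(Capacity, t) \<notin> J" "exp_bounded g" "\<And>x. 0 \<le> g x"
  shows "expectation (\<lambda>\<omega>. g (X \<omega> - K t \<omega>)) = expectation (\<lambda>\<omega>. serve cap g (X \<omega>))"
  using expectation_fresh_input[OF assms(1,2), of cap "\<lambda>x k. g (x - k)"] assms(3-) distr_K
  by (simp add: serve_def integrable_serve)

definition past :: "nat \<Rightarrow> (source \<times> nat) set" where
  "past t = {(s, i). i < t}"

abbreviation rate :: "nat \<Rightarrow> real" where
  "rate \<equiv> express_rate lam Umin Umax \<pi>"

abbreviation total :: "nat \<Rightarrow> nat \<Rightarrow> 'a \<Rightarrow> nat" where
  "total xS t \<omega> \<equiv> total_backlog xS (\<lambda>t. E t \<omega>) (\<lambda>t. N t \<omega>) (\<lambda>t. K t \<omega>) t"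

abbreviation high :: "nat \<Rightarrow> nat \<Rightarrow> nat \<Rightarrow> 'a \<Rightarrow> nat" where
  "high xS xh t \<omega> \<equiv> high_backlog T xS xh (\<lambda>t. E t \<omega>) (\<lambda>t. N t \<omega>) (\<lambda>t. K t \<omega>) t"

lemma determined_by_inputs:
  "(Express, t) \<in> J \<Longrightarrow> determined_by J (E t)"
  "(Regular, t) \<in> J \<Longrightarrow> determined_by J (N t)"
  "(Capacity, t) \<in> J \<Longrightarrow> determined_by J (K t)"
  using determined_by_input[of "(Express, t)" J] determined_by_input[of "(Regular, t)" J]
    determined_by_input[of "(Capacity, t)" J] by simp_all

lemma determined_by_total: "determined_by (past t) (total xS t)"
proof (induction t)
  case 0
  show ?case by (simp add: determined_by_const)
next
  case (Suc t)
  have "determined_by (past (Suc t)) (total xS t)"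
    by (rule determined_by_superset[OF Suc]) (auto simp: past_def)
  then show ?case
    unfolding total_backlog.simps
    by (intro determined_by_binop[of _ _ _ "(-)"] determined_by_binop[of _ _ _ "(+)"]
        determined_by_inputs) (auto simp: past_def)
qed

lemma determined_by_high: "determined_by (past t) (high xS xh t)"
proof (induction t)
  case 0
  show ?case by (simp add: determined_by_const)
next
  case (Suc t)
  have h: "determined_by (past (Suc t)) (high xS xh t)"
    by (rule determined_by_superset[OF Suc]) (auto simp: past_def)
  show ?case
  proof (cases "t mod T \<noteq> T - 1")
    case True
    then show ?thesis
      using h by (simp del: One_nat_def)
        (intro determined_by_binop[of _ _ _ "(-)"] determined_by_binop[of _ _ _ "(+)"]
          determined_by_inputs, auto simp: past_def)
  next
    case False
    then show ?thesis using determined_by_total[of "Suc t" xS] by simp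
  qed
qed

text \<open>The period before the start of a cycle has age \<open>T - 1\<close>, at which the high-urgency backlog is
  reset. Only the first cycle has no such period.\<close>

lemma high_at_cycle_start:
  assumes "0 < T" "0 < l"
  shows "high xS xh (l * T) \<omega> = total xS (l * T) \<omega>"
proof -
  obtain t where t: "l * T = Suc t" using assms by (metis gr0_implies_Suc nat_0_less_mult_iff)
  have "t = (l - 1) * T + (T - 1)"
    using t assms by (cases l) auto
  then have "t mod T = (T - 1) mod T" by (simp only: mod_mult_self3)
  then have "t mod T = T - 1" using assms by simp
  then show ?thesis unfolding t by simp
qed

lemma expectation_high_step:
  assumes "exp_bounded g" "\<And>x. 0 \<le> g x" "0 \<le> rate (t mod T)"
  shows "expectation (\<lambda>\<omega>. g (high xS xh t \<omega> + E t \<omega> - K t \<omega>)) =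
    expectation (\<lambda>\<omega>. arrive (rate (t mod T)) (serve cap g) (high xS xh t \<omega>))"
proof -
  let ?J = "insert (Express, t) (past t)"
  have "determined_by ?J (\<lambda>\<omega>. high xS xh t \<omega> + E t \<omega>)"
    by (intro determined_by_binop[of _ _ _ "(+)"] determined_by_inputs
        determined_by_superset[OF determined_by_high]) auto
  then have "expectation (\<lambda>\<omega>. g (high xS xh t \<omega> + E t \<omega> - K t \<omega>)) =
      expectation (\<lambda>\<omega>. serve cap g (high xS xh t \<omega> + E t \<omega>))"
    by (rule expectation_serve) (use assms in \<open>auto simp: past_def\<close>)
  also have "\<dots> = expectation (\<lambda>\<omega>. arrive (rate (t mod T)) (serve cap g) (high xS xh t \<omega>))"
    using expectation_arrive[OF determined_by_high, of "(Express, t)" t "rate (t mod T)" "serve cap g" xS xh]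
      assms distr_E
    by (simp add: past_def express_law_rate serve_nonneg averaging_exp_bounded[OF averaging_serve])
  finally show ?thesis .
qed

text \<open>For \<open>j < T\<close> no reset occurs between the start of the cycle and age \<open>j\<close>.\<close>

lemma expectation_high_stages:
  assumes rate: "\<And>\<tau>. 0 \<le> rate \<tau>" and "exp_bounded g" "\<And>x. 0 \<le> g x" "j < T"
  shows "expectation (\<lambda>\<omega>. g (high xS xh (l * T + j) \<omega>)) =
    expectation (\<lambda>\<omega>. stages cap rate j g (high xS xh (l * T) \<omega>))"
  using assms(2-)
proof (induction j arbitrary: g)
  case 0
  then show ?case by simp
next
  case (Suc j)
  have j: "(l * T + j) mod T = j" "j \<noteq> T - 1" using Suc.prems by auto
  let ?g = "arrive (rate j) (serve cap g)"
  have "expectation (\<lambda>\<omega>. g (high xS xh (l * T + Suc j) \<omega>)) =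
      expectation (\<lambda>\<omega>. ?g (high xS xh (l * T + j) \<omega>))"
    using expectation_high_step[OF Suc.prems(1,2), of "l * T + j" xS xh] j rate by simp
  also have "\<dots> = expectation (\<lambda>\<omega>. stages cap rate j ?g (high xS xh (l * T) \<omega>))"
    using Suc.prems rate
    by (intro Suc.IH arrive_nonneg serve_nonneg averaging_exp_bounded[OF averaging_arrive]
        averaging_exp_bounded[OF averaging_serve]) auto
  finally show ?case by simp
qed

lemma expectation_backorders:
  assumes rate: "\<And>\<tau>. 0 \<le> rate \<tau>" and "0 < T"
  shows "expectation (\<lambda>\<omega>. real (backorders T xS xh (\<lambda>t. E t \<omega>) (\<lambda>t. N t \<omega>) (\<lambda>t. K t \<omega>) l)) =
    expectation (\<lambda>\<omega>. stages cap rate T real (high xS xh (l * T) \<omega>))"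
proof -
  obtain m where m: "T = Suc m" using assms(2) by (cases T) auto
  let ?g = "arrive (rate m) (serve cap real)"
  have "expectation (\<lambda>\<omega>. real (backorders T xS xh (\<lambda>t. E t \<omega>) (\<lambda>t. N t \<omega>) (\<lambda>t. K t \<omega>) l)) =
      expectation (\<lambda>\<omega>. ?g (high xS xh (l * T + m) \<omega>))"
  proof -
    have idx: "l * T + T - 1 = l * T + m" using m by simp
    have "(l * T + m) mod T = m mod T" by (simp only: mod_mult_self3)
    then have mod: "(l * T + m) mod T = m" using m by simp
    show ?thesis
      unfolding backorders_def Let_def idx
      using expectation_high_step[OF exp_bounded_real, of "l * T + m" xS xh, unfolded mod] rate
      by simp
  qed
  also have "\<dots> = expectation (\<lambda>\<omega>. stages cap rate m ?g (high xS xh (l * T) \<omega>))"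
    using rate m
    by (intro expectation_high_stages arrive_nonneg serve_nonneg
        averaging_exp_bounded[OF averaging_arrive]
        averaging_exp_bounded[OF averaging_serve] exp_bounded_real) auto
  finally show ?thesis by (simp add: m)
qed

text \<open>Here the policy disappears: the express rate and the regular rate add up to \<open>lam\<close>.\<close>

lemma expectation_total_step:
  assumes "exp_bounded g" "\<And>x. 0 \<le> g x" "0 \<le> rate (t mod T)" "rate (t mod T) \<le> lam"
  shows "expectation (\<lambda>\<omega>. g (total xS (Suc t) \<omega>)) = expectation (\<lambda>\<omega>. period cap lam g (total xS t \<omega>))"
proof -
  let ?r = "rate (t mod T)"
  let ?J = "insert (Express, t) (past t)" and ?J' = "insert (Regular, t) (insert (Express, t) (past t))"
  have eb: "exp_bounded (serve cap g)" "exp_bounded (arrive (lam - ?r) (serve cap g))"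
    using assms
    by (auto intro!: averaging_exp_bounded[OF averaging_arrive] averaging_exp_bounded[OF averaging_serve])
  have J: "determined_by ?J (\<lambda>\<omega>. total xS t \<omega> + E t \<omega>)"
    by (intro determined_by_binop[of _ _ _ "(+)"] determined_by_inputs
        determined_by_superset[OF determined_by_total]) auto
  then have "determined_by ?J' (\<lambda>\<omega>. total xS t \<omega> + E t \<omega> + N t \<omega>)"
    by (intro determined_by_binop[of _ _ _ "(+)"] determined_by_inputs
        determined_by_superset[OF J]) auto
  then have "expectation (\<lambda>\<omega>. g (total xS t \<omega> + E t \<omega> + N t \<omega> - K t \<omega>)) =
      expectation (\<lambda>\<omega>. serve cap g (total xS t \<omega> + E t \<omega> + N t \<omega>))"
    by (rule expectation_serve) (use assms in \<open>auto simp: past_def\<close>)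
  also have "\<dots> = expectation (\<lambda>\<omega>. arrive (lam - ?r) (serve cap g) (total xS t \<omega> + E t \<omega>))"
    using expectation_arrive[OF J, of "(Regular, t)" "lam - ?r" "serve cap g"] assms distr_N eb
    by (simp add: past_def regular_law_rate serve_nonneg)
  also have "\<dots> = expectation (\<lambda>\<omega>. arrive ?r (arrive (lam - ?r) (serve cap g)) (total xS t \<omega>))"
    using expectation_arrive[OF determined_by_total, of "(Express, t)" t ?r
        "arrive (lam - ?r) (serve cap g)" xS] assms distr_E eb
    by (simp add: past_def express_law_rate serve_nonneg arrive_nonneg)
  also have "arrive ?r (arrive (lam - ?r) (serve cap g)) = period cap lam g"
    using assms eb by (simp add: arrive_arrive serve_nonneg period_def)
  finally show ?thesis by (simp add: add.assoc)
qed

lemma expectation_total: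
  assumes rate: "\<And>\<tau>. 0 \<le> rate \<tau>" "\<And>\<tau>. rate \<tau> \<le> lam" and "exp_bounded g" "\<And>x. 0 \<le> g x"
  shows "expectation (\<lambda>\<omega>. g (total xS t \<omega>)) = (period cap lam ^^ t) g xS"
  using assms(3-)
proof (induction t arbitrary: g)
  case 0
  then show ?case by (simp add: prob_space)
next
  case (Suc t)
  have lam: "0 \<le> lam" using rate(1)[of 0] rate(2)[of 0] by simp
  have "expectation (\<lambda>\<omega>. g (total xS (Suc t) \<omega>)) =
      expectation (\<lambda>\<omega>. period cap lam g (total xS t \<omega>))"
    using Suc.prems rate by (intro expectation_total_step) auto
  also have "\<dots> = (period cap lam ^^ t) (period cap lam g) xS"
    using Suc.prems lam
    by (intro Suc.IH averaging_exp_bounded[OF averaging_period]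
        averaging_nonneg[OF averaging_period]) auto
  finally show ?case by (simp add: funpow_swap1)
qed

lemma expected_backorders_eq:
  assumes rate: "\<And>\<tau>. 0 \<le> rate \<tau>" "\<And>\<tau>. rate \<tau> \<le> lam" and T: "0 < T"
  shows "expected_backorders M T xS xh E N K =
    lim (\<lambda>L. 1 / real L * (\<Sum>l<L. if l = 0 then stages cap rate T real xh
      else (period cap lam ^^ (l * T)) (stages cap rate T real) xS))"
proof -
  have "expectation (\<lambda>\<omega>. real (backorders T xS xh (\<lambda>t. E t \<omega>) (\<lambda>t. N t \<omega>) (\<lambda>t. K t \<omega>) l)) =
      (if l = 0 then stages cap rate T real xh
       else (period cap lam ^^ (l * T)) (stages cap rate T real) xS)" for l
  proof (cases "l = 0")
    case True
    then show ?thesis by (simp add: expectation_backorders[OF rate(1) T] prob_space)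
  next
    case False
    have "expectation (\<lambda>\<omega>. real (backorders T xS xh (\<lambda>t. E t \<omega>) (\<lambda>t. N t \<omega>) (\<lambda>t. K t \<omega>) l)) =
        expectation (\<lambda>\<omega>. stages cap rate T real (total xS (l * T) \<omega>))"
      using False by (simp add: expectation_backorders[OF rate(1) T] high_at_cycle_start[OF T])
    also have "\<dots> = (period cap lam ^^ (l * T)) (stages cap rate T real) xS"
      using rate
      by (intro expectation_total averaging_exp_bounded[OF averaging_stages]
          averaging_nonneg[OF averaging_stages] exp_bounded_real) auto
    finally show ?thesis using False by simp
  qed
  then show ?thesis unfolding expected_backorders_def by simp
qed

end

section \<open>Long-run average of the backorders\<close>

lemma cesaro_mean:
  fixes f :: "nat \<Rightarrow> real"
  assumes "f \<longlonglongrightarrow> a"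
  shows "(\<lambda>L. 1 / real L * (\<Sum>l<L. f l)) \<longlonglongrightarrow> a"
proof (rule LIMSEQ_I)
  fix \<epsilon> :: real
  assume "0 < \<epsilon>"
  then obtain m where m: "\<bar>f l - a\<bar> < \<epsilon> / 2" if "m \<le> l" for l
    using LIMSEQ_D[OF assms, of "\<epsilon> / 2"] by auto
  define S where "S = (\<Sum>l<m. \<bar>f l - a\<bar>)"
  have S: "0 \<le> S" by (simp add: S_def sum_nonneg)
  obtain n where n: "2 * S / \<epsilon> < real n" using reals_Archimedean2 by blast
  show "\<exists>n. \<forall>L\<ge>n. norm (1 / real L * (\<Sum>l<L. f l) - a) < \<epsilon>"
  proof (intro exI allI impI)
    fix L
    assume L: "max 1 (max m n) \<le> L"
    have "\<bar>\<Sum>l<L. f l - a\<bar> \<le> (\<Sum>l<L. \<bar>f l - a\<bar>)" by (rule sum_abs)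
    also have "\<dots> = S + (\<Sum>l=m..<L. \<bar>f l - a\<bar>)"
      using L unfolding S_def lessThan_atLeast0 by (subst sum.atLeastLessThan_concat) auto
    also have "(\<Sum>l=m..<L. \<bar>f l - a\<bar>) \<le> (\<Sum>l=m..<L. \<epsilon> / 2)"
      using m by (intro sum_mono) (auto intro: less_imp_le)
    also have "\<dots> \<le> real L * (\<epsilon> / 2)"
      using \<open>0 < \<epsilon>\<close> by (simp add: mult_right_mono)
    finally have "\<bar>\<Sum>l<L. f l - a\<bar> \<le> S + real L * (\<epsilon> / 2)" by simp
    moreover have "2 * S < real n * \<epsilon>" using n \<open>0 < \<epsilon>\<close> by (simp add: divide_less_eq)
    moreover have "real n * \<epsilon> \<le> real L * \<epsilon>" using L \<open>0 < \<epsilon>\<close> by (simp add: mult_right_mono)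
    ultimately have "\<bar>\<Sum>l<L. f l - a\<bar> < real L * \<epsilon>" by simp
    moreover have "1 / real L * (\<Sum>l<L. f l) - a = (\<Sum>l<L. f l - a) / real L"
      using L by (simp add: sum_subtractf field_simps)
    ultimately show "norm (1 / real L * (\<Sum>l<L. f l) - a) < \<epsilon>"
      using L by (simp add: abs_divide divide_less_eq mult.commute)
  qed
qed

text \<open>The defining average exists as a limit, and the first cycle and the averaging can be dropped. The
  limit is along all periods, of which the cycle starts form a subsequence.\<close>

lemma (in shipment_process) expected_backorders_limit:
  assumes "geometric_drift cap lam q" and rate: "\<And>\<tau>. 0 \<le> rate \<tau>" "\<And>\<tau>. rate \<tau> \<le> lam"
    and T: "0 < T"
  shows "(\<lambda>t. (period cap lam ^^ t) (stages cap rate T real) xS)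
    \<longlonglongrightarrow> expected_backorders M T xS xh E N K"
proof -
  interpret geometric_drift cap lam q by fact
  let ?h = "stages cap rate T real"
  let ?b = "\<lambda>l. if l = 0 then ?h xh else (period cap lam ^^ (l * T)) ?h xS"
  obtain c where "0 \<le> c" "geo_lipschitz q c ?h"
    using geo_lipschitz_stages[of q rate real "1 / (q - 1)" cap T] q rate(1)
      geo_lipschitz_real[OF q] exp_bounded_real by auto
  then obtain B where B: "(\<lambda>t. (period cap lam ^^ t) ?h xS) \<longlonglongrightarrow> B"
    using periods_convergent[OF averaging_exp_bounded[OF averaging_stages exp_bounded_real]] rate(1)
    unfolding convergent_def by blast
  have "(\<lambda>l. (period cap lam ^^ (l * T)) ?h xS) \<longlonglongrightarrow> B"
    using LIMSEQ_subseq_LIMSEQ[OF B, of "\<lambda>l. l * T"] T by (simp add: strict_mono_def o_def)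
  then have "?b \<longlonglongrightarrow> B"
    by (rule Lim_transform_eventually) (rule eventually_mono[OF eventually_gt_at_top[of 0]], simp)
  then have "expected_backorders M T xS xh E N K = B"
    unfolding expected_backorders_eq[OF rate T] by (intro limI cesaro_mean)
  with B show ?thesis by simp
qed

section \<open>Constant policies\<close>

lemma fee_const_policy [simp]: "j \<le> k \<Longrightarrow> fee (const_policy k f) j = f"
  unfolding const_policy_def snd_conv by (rule nth_replicate) simp

lemma cutoff_const_policy [simp]: "cutoff (const_policy k f) = k"
  by (simp add: const_policy_def)

lemma demand_profile_const_policy:
  assumes "k \<le> \<tau>"
  shows "demand_profile lam Umin Umax (const_policy k f) \<tau> =
    lam * (real (Suc k) * express_share Umin Umax f)"
  using assms by (simp add: demand_profile_def min_absorb2)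

lemma expected_revenue_const_policy:
  "expected_revenue lam Umin Umax (const_policy k f) =
    f * (lam * (real (Suc k) * express_share Umin Umax f))"
  by (simp add: expected_revenue_def mult_ac)

lemma sum_express_rate_const_policy:
  "(\<Sum>\<tau><n. express_rate lam Umin Umax (const_policy k f) \<tau>) =
    real (min n (Suc k)) * (express_share Umin Umax f * lam)"
proof (induction n)
  case (Suc n)
  then show ?case
    by (cases "n \<le> k") (auto simp: express_rate_def min_def le_Suc_eq algebra_simps)
qed simp

lemma capacity_exceeds_demand:
  assumes "0 < lam" "ennreal lam / I < 1"
  shows "ennreal lam < I"
proof (rule ccontr)
  assume "\<not> ennreal lam < I"
  then have le: "I \<le> ennreal lam" by simp
  show False
  proof (cases "I = 0")
    case True
    \<comment> \<open>Division by 0 gives \<open>top\<close> here, which is not below 1.\<close>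
    then show ?thesis using assms by (simp add: ennreal_divide_zero)
  next
    case False
    have "I < top" using le by (rule order_le_less_trans) simp
    then have "1 = I / I" using False by (simp add: ennreal_divide_self)
    also have "\<dots> \<le> ennreal lam / I" using le by (rule divide_right_mono_ennreal)
    finally show ?thesis using assms(2) by simp
  qed
qed

text \<open>With the shares \<open>w\<close> at the fee \<open>f\<close> and \<open>w'\<close> at the fee \<open>f'\<close>, the first \<open>n\<close> ages contribute
  the rate \<open>min n (k + 1) * w' * lam\<close> under the cutoff policy and \<open>n * w * lam\<close> under the constant one.
  The cutoff policy is ahead: up to the cutoff point because \<open>w < w'\<close>, and afterwards because it has
  already reached the common total. At the end of the cycle no surplus is left.\<close>

lemma stages_earlier_cutoff_less:
  assumes cap: "set_pmf cap = UNIV" and share: "0 < express_share Umin Umax f" and lam: "0 < lam"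
    and k: "Suc k < T"
    and demand: "real T * express_share Umin Umax f = real (Suc k) * express_share Umin Umax f'"
  shows "stages cap (express_rate lam Umin Umax (const_policy k f')) T real x <
    stages cap (express_rate lam Umin Umax (const_policy (T - 1) f)) T real x"
proof -
  let ?r = "express_rate lam Umin Umax (const_policy (T - 1) f)"
  let ?r' = "express_rate lam Umin Umax (const_policy k f')"
  let ?w = "express_share Umin Umax f" and ?w' = "express_share Umin Umax f'"
  have T: "Suc (T - 1) = T" using k by simp
  have "real (Suc k) * ?w < real T * ?w"
    using k share by (intro mult_strict_right_mono) auto
  then have w: "?w < ?w'"
    unfolding demand by (rule mult_left_less_imp_less) simp
  have "stages cap ?r' T real x <
      stages cap ?r T (arrive ((\<Sum>i<T. ?r' i) - (\<Sum>i<T. ?r i)) real) x"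
  proof (rule stages_earlier_less[OF cap, where m = T])
    fix n
    assume n: "n \<le> T"
    have "real (min n T) * ?w \<le> real (min n (Suc k)) * ?w'"
    proof (cases "n \<le> Suc k")
      case True
      then show ?thesis using w n by (auto simp: min_absorb1 intro!: mult_left_mono)
    next
      case False
      have "real n * ?w \<le> real T * ?w" using n share by (intro mult_right_mono) auto
      then show ?thesis using False n demand by (simp add: min_absorb1 min_absorb2)
    qed
    then show "(\<Sum>i<n. ?r i) \<le> (\<Sum>i<n. ?r' i)"
      using lam unfolding sum_express_rate_const_policy T by (simp add: mult.assoc[symmetric])
  qed (use share lam w k in \<open>auto simp: express_rate_def exp_bounded_real strict_mono_def\<close>)
  moreover have "(\<Sum>i<T. ?r' i) = (\<Sum>i<T. ?r i)"
    using k demand unfolding sum_express_rate_const_policy T by (simp add: min_absorb2 mult.assoc[symmetric])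
  ultimately show ?thesis by simp
qed

theorem lemma3:
  fixes T xS xh k :: nat and lam \<beta> Umin Umax f f' :: real
    and cap :: "nat pmf" and \<pi>c \<pi>cc :: policy
    and M :: "'a measure" and E N K :: "nat \<Rightarrow> 'a \<Rightarrow> nat"
    and M' :: "'b measure" and E' N' K' :: "nat \<Rightarrow> 'b \<Rightarrow> nat"
  defines "C \<equiv> \<lambda>\<pi>. demand_profile lam Umin Umax \<pi> (T - 1)"
    and "Bc \<equiv> expected_backorders M T xS xh E N K"
    and "Bcc \<equiv> expected_backorders M' T xS xh E' N' K'"
    and "Gc \<equiv> expected_profit \<beta> lam Umin Umax \<pi>c M T xS xh E N K"
    and "Gcc \<equiv> expected_profit \<beta> lam Umin Umax \<pi>cc M' T xS xh E' N' K'"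
  assumes "T \<ge> 1" and "lam > 0" and "\<beta> > 0" and "0 \<le> Umin" and "Umin < Umax"
    and "set_pmf cap = UNIV"
    and "ennreal lam / (\<integral>\<^sup>+ j. ennreal (real j) \<partial>measure_pmf cap) < 1"
    and "xh \<le> xS"
    and "\<pi>c \<in> const_policies T Umin Umax" and "\<pi>c = const_policy (T - 1) f"
    and "\<pi>cc \<in> const_cutoff_policies T Umin Umax - const_policies T Umin Umax"
    and "\<pi>cc = const_policy k f'"
    and "shipment_process M T lam Umin Umax cap \<pi>c E N K"
    and "shipment_process M' T lam Umin Umax cap \<pi>cc E' N' K'"
    and "C \<pi>c = C \<pi>cc"
  shows "(f < Umax \<longrightarrow> f' < f) \<and>
    Bcc \<le> Bc \<and>
    (Gcc \<ge> Gc \<longleftrightarrow> \<beta> \<ge> (f - f') * (C \<pi>cc / (Bc - Bcc)))"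
proof -
  \<comment> \<open>Keeps \<open>T - 1\<close> in the form in which the hypotheses have it.\<close>
  note [simp del] = One_nat_def
  let ?w = "express_share Umin Umax"
  let ?r = "express_rate lam Umin Umax \<pi>c" and ?r' = "express_rate lam Umin Umax \<pi>cc"
  let ?h = "stages cap ?r T real" and ?h' = "stages cap ?r' T real"
  have \<pi>c: "\<pi>c \<in> policies T Umin Umax" and \<pi>cc: "\<pi>cc \<in> policies T Umin Umax"
    using assms by (auto simp: const_policies_def const_cutoff_policies_def)
  have "k < T" using \<pi>cc \<open>\<pi>cc = const_policy k f'\<close> by (simp add: policies_def)
  moreover have "k \<noteq> T - 1" using assms by (auto simp: const_policies_def)
  ultimately have k: "Suc k < T" by simp
  have "f \<in> set (snd \<pi>c)" unfolding \<open>\<pi>c = const_policy (T - 1) f\<close> by (simp add: const_policy_def)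
  then have f: "f \<le> Umax" using \<pi>c by (auto simp: policies_def)

  have Cc: "C \<pi>c = lam * (real T * ?w f)"
    using \<open>T \<ge> 1\<close> unfolding C_def \<open>\<pi>c = const_policy (T - 1) f\<close>
    by (subst demand_profile_const_policy) auto
  have Ccc: "C \<pi>cc = lam * (real (Suc k) * ?w f')"
    using k unfolding C_def \<open>\<pi>cc = const_policy k f'\<close>
    by (subst demand_profile_const_policy) auto
  have demand: "real T * ?w f = real (Suc k) * ?w f'"
    using \<open>C \<pi>c = C \<pi>cc\<close> \<open>lam > 0\<close> unfolding Cc Ccc by simp

  have Gc: "Gc = f * C \<pi>cc - \<beta> * Bc"
    using \<open>T \<ge> 1\<close> unfolding Gc_def expected_profit_def Bc_def \<open>C \<pi>c = C \<pi>cc\<close>[symmetric] Cc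
    unfolding \<open>\<pi>c = const_policy (T - 1) f\<close> expected_revenue_const_policy by simp
  have Gcc: "Gcc = f' * C \<pi>cc - \<beta> * Bcc"
    unfolding Gcc_def expected_profit_def Bcc_def Ccc
    unfolding \<open>\<pi>cc = const_policy k f'\<close> expected_revenue_const_policy by simp

  obtain q where "1 < q"
      "exp (lam * (q - 1)) * measure_pmf.expectation cap (\<lambda>k. (1 / q) ^ k) < 1"
    using exists_geometric_drift[of lam cap] capacity_exceeds_demand assms by force
  then interpret geometric_drift cap lam q
    using \<open>lam > 0\<close> by unfold_locales auto
  have gd: "geometric_drift cap lam q" by (rule geometric_drift_axioms)
  have limc: "(\<lambda>t. (period cap lam ^^ t) ?h xS) \<longlonglongrightarrow> Bc"
    unfolding Bc_def using assms express_rate_bounds[OF \<pi>c]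
    by (intro shipment_process.expected_backorders_limit[OF _ gd]) auto
  have limcc: "(\<lambda>t. (period cap lam ^^ t) ?h' xS) \<longlonglongrightarrow> Bcc"
    unfolding Bcc_def using assms express_rate_bounds[OF \<pi>cc]
    by (intro shipment_process.expected_backorders_limit[OF _ gd]) auto

  show ?thesis
  proof (cases "f < Umax")
    case True
    have w: "0 < ?w f" using True \<open>Umin < Umax\<close> by (simp add: express_share_def)
    have "real (Suc k) * ?w f < real T * ?w f"
      using k w by (intro mult_strict_right_mono) auto
    then have "?w f < ?w f'"
      unfolding demand by (rule mult_left_less_imp_less) simp
    then have ff: "f' < f"
      using \<open>Umin < Umax\<close> by (simp add: express_share_def divide_less_cancel)
    have "?h' x < ?h x" for x
      using stages_earlier_cutoff_less[OF \<open>set_pmf cap = UNIV\<close> w \<open>lam > 0\<close> k demand]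
      by (simp only: \<open>\<pi>c = const_policy (T - 1) f\<close> \<open>\<pi>cc = const_policy k f'\<close>)
    moreover have "exp_bounded ?h" "exp_bounded ?h'"
      using express_rate_bounds(1)[OF \<pi>c] express_rate_bounds(1)[OF \<pi>cc] assms
      by (auto intro!: averaging_exp_bounded[OF averaging_stages] exp_bounded_real)
    ultimately obtain \<epsilon> where "0 < \<epsilon>"
        "\<And>t. (period cap lam ^^ t) ?h' xS + \<epsilon> \<le> (period cap lam ^^ t) ?h xS"
      using periods_gap by blast
    then have "Bcc + \<epsilon> \<le> Bc"
      by (intro LIMSEQ_le[OF tendsto_add[OF limcc tendsto_const] limc]) auto
    then have B: "Bcc < Bc" using \<open>0 < \<epsilon>\<close> by simp
    have "Gcc \<ge> Gc \<longleftrightarrow> (f - f') * C \<pi>cc \<le> \<beta> * (Bc - Bcc)"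
      unfolding Gc Gcc by (simp add: algebra_simps)
    also have "\<dots> \<longleftrightarrow> (f - f') * (C \<pi>cc / (Bc - Bcc)) \<le> \<beta>"
      using B by (simp add: pos_divide_le_eq)
    finally show ?thesis using ff B by simp
  next
    case False
    then have w: "?w f = 0" using f by (simp add: express_share_def)
    then have w': "?w f' = 0" using demand by simp
    then have ff: "f' = f" using w \<open>Umin < Umax\<close> by (simp add: express_share_def)
    have "?r = ?r'"
      using w w' \<open>\<pi>c = const_policy (T - 1) f\<close> \<open>\<pi>cc = const_policy k f'\<close>
      by (auto simp: express_rate_def fun_eq_iff)
    then have "Bc = Bcc" using limc limcc by (auto intro: LIMSEQ_unique)
    then show ?thesis using False ff \<open>\<beta> > 0\<close> unfolding Gc Gcc by simp
  qed
qed

end
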